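(* $U_q=\mathcal N_{-1}\,U_q(\mathfrak g_{\bar 0})\,\mathcal N_1$; that is, $U_q$ is spanned over $\mathbb F(q)$ by the products $x\,u\,y$ with $x\in\mathcal N_{-1}$, $u\in U_q(\mathfrak g_{\bar0})$, $y\in\mathcal N_1$.
   Context: Let $m,n\ge1$, $\mathbb F$ a field of characteristic $0$, $q$ an indeterminate, $q_i=q$ for $i\le m$ and $q_i=q^{-1}$ for $i>m$; $\mathcal I_1=\{(i,j):1\le i\le m<j\le m+n\}$. $U_q=U_q(\mathfrak{gl}(m,n))$ is the associative unital $\mathbb F(q)$-superalgebra with generators $E_{i,i+1},F_{i,i+1}$ ($1\le i<m+n$), $K_j^{\pm1}$ ($1\le j\le m+n$), where $E_{m,m+1},F_{m,m+1}$ are odd and all other generators even, and relations (with $[x,y]=xy-(-1)^{\bar x\bar y}yx$; relations with out-of-range indices are omitted) (R1) $K_iK_j=K_jK_i$, $K_iK_i^{-1}=K_i^{-1}K_i=1$; (R2) $K_iE_{j,j+1}K_i^{-1}=q_i^{\delta_{ij}-\delta_{i,j+1}}E_{j,j+1}$, $K_iF_{j,j+1}K_i^{-1}=q_i^{-(\delta_{ij}-\delta_{i,j+1})}F_{j,j+1}$; (R3) $[E_{i,i+1},F_{j,j+1}]=\delta_{ij}\dfrac{K_iK_{i+1}^{-1}-K_i^{-1}K_{i+1}}{q_i-q_i^{-1}}$; (R4) $E_{m,m+1}^2=F_{m,m+1}^2=0$; (R5) $E_{i,i+1}E_{j,j+1}=E_{j,j+1}E_{i,i+1}$, $F_{i,i+1}F_{j,j+1}=F_{j,j+1}F_{i,i+1}$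 if $|i-j|>1$; (R6) $E_{i,i+1}^2E_{j,j+1}-(q+q^{-1})E_{i,i+1}E_{j,j+1}E_{i,i+1}+E_{j,j+1}E_{i,i+1}^2=0$ if $|i-j|=1$, $i\ne m$; (R7) the same as (R6) with $F$ in place of $E$; (R8) $[E_{m-1,m+2},E_{m,m+1}]=[F_{m-1,m+2},F_{m,m+1}]=0$, where for $i<c<j$, $E_{ij}=E_{ic}E_{cj}-q_c^{-1}E_{cj}E_{ic}$ and $F_{ij}=-q_cF_{ic}F_{cj}+F_{cj}F_{ic}$ (independent of $c$). $U_q(\mathfrak g_{\bar0})$ denotes here the subalgebra of $U_q$ generated by $E_{i,i+1},F_{i,i+1}$ ($i\neq m$) and all $K_j^{\pm1}$. For $d=(d_{ij})_{(i,j)\in\mathcal I_1}$ with $d_{ij}\in\{0,1\}$, $E_1^d=\prod_{(i,j)\in\mathcal I_1}E_{ij}^{d_{ij}}$, the product in increasing lexicographic order of $(i,j)$ (i.e. $E_{ij}$ to the left of $E_{st}$ if $i<s$, or $i=s$ and $j<t$). $\mathcal N_1$ is the $\mathbb F(q)$-span of all $E_1^d$, and $\mathcal N_{-1}=\Omega(\mathcal N_1)$, where $\Omega$ is the ($\mathbb F$-linear, ungraded) anti-automorphism of $U_q$ with $\Omega(E_{i,i+1})=F_{i,i+1}$, $\Omega(F_{i,i+1})=E_{i,i+1}$, $\Omega(K_j)=K_j^{-1}$, $\Omega(q)=q^{-1}$; it satisfies $\Omega(E_{ij})=F_{ij}$. *)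

theory Defs
  imports
    "HOL-Library.Poly_Mapping"
    "HOL-Computational_Algebra.Polynomial"
    "HOL-Computational_Algebra.Fraction_Field"
    "HOL-Algebra.QuotRing"
    "HOL-Algebra.Generated_Rings"
begin

section \<open>The ground field $\mathbb F(q)$\<close>

type_synonym 'f ratfun = "'f poly fract"

definition qconst :: "'f::field \<Rightarrow> 'f ratfun" where
  "qconst a = Fract [:a:] 1"

definition qq :: "'f::field ratfun" where
  "qq = Fract [:0, 1:] 1"

definition eval_qinv :: "'f::field poly \<Rightarrow> 'f ratfun" where
  "eval_qinv p = poly (map_poly qconst p) (inverse qq)"

text \<open>The field automorphism of $\mathbb F(q)$ over $\mathbb F$ with $q \mapsto q^{-1}$; see
  \<open>qbar_Fract\<close> below for independence of the representative.\<close>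
definition qbar :: "'f::field ratfun \<Rightarrow> 'f ratfun" where
  "qbar x = eval_qinv (fst (rep_fract x)) / eval_qinv (snd (rep_fract x))"

section \<open>The free algebra\<close>

text \<open>Words form a monoid under concatenation, so that finitely supported functions from words
  to $\mathbb F(q)$, with the convolution product of \<^theory>\<open>HOL-Library.Poly_Mapping\<close>, are the
  free associative algebra.\<close>

instantiation list :: (type) monoid_add
begin
definition zero_list :: "'a list" where "zero_list = []"
definition plus_list :: "'a list \<Rightarrow> 'a list \<Rightarrow> 'a list" where "plus_list = (@)"
instance by standard (simp_all add: zero_list_def plus_list_def)
end

text \<open>\<open>GE i\<close> and \<open>GF i\<close> stand for $E_{i,i+1}$ and $F_{i,i+1}$.\<close>
datatype uq_gen = GE nat | GF nat | GK nat | GKinv nat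

fun gen_ok :: "nat \<Rightarrow> nat \<Rightarrow> uq_gen \<Rightarrow> bool" where
  "gen_ok m n (GE i) \<longleftrightarrow> 1 \<le> i \<and> i < m + n"
| "gen_ok m n (GF i) \<longleftrightarrow> 1 \<le> i \<and> i < m + n"
| "gen_ok m n (GK j) \<longleftrightarrow> 1 \<le> j \<and> j \<le> m + n"
| "gen_ok m n (GKinv j) \<longleftrightarrow> 1 \<le> j \<and> j \<le> m + n"

type_synonym 'f falg = "uq_gen list \<Rightarrow>\<^sub>0 'f poly fract"

definition scal :: "'f::field ratfun \<Rightarrow> 'f falg" where
  "scal c = Poly_Mapping.single [] c"

definition gen :: "uq_gen \<Rightarrow> 'f::field falg" where
  "gen g = Poly_Mapping.single [g] 1"

abbreviation "gE i \<equiv> gen (GE i)"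
abbreviation "gF i \<equiv> gen (GF i)"
abbreviation "gK j \<equiv> gen (GK j)"
abbreviation "gKinv j \<equiv> gen (GKinv j)"

definition free_alg :: "nat \<Rightarrow> nat \<Rightarrow> 'f::field falg ring" where
  "free_alg m n =
    \<lparr>carrier = {x. \<forall>w \<in> Poly_Mapping.keys x. \<forall>g \<in> set w. gen_ok m n g},
     monoid.mult = (*), one = 1, zero = 0, add = (+)\<rparr>"

section \<open>Root vectors and the defining relations\<close>

definition qi :: "nat \<Rightarrow> nat \<Rightarrow> 'f::field ratfun" where
  "qi m i = (if i \<le> m then qq else inverse qq)"

text \<open>$E_{ij}$ and $F_{ij}$ for $i < j$, as elements of the free algebra, with the choice
  $c = j - 1$ in the recursion (the value \<open>0\<close> for $i \ge j$ is a dummy). That every other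
  $c$ gives the same element of $U_q$ is \<open>rootE_split\<close> and \<open>rootF_split\<close> below.\<close>
fun rootE :: "nat \<Rightarrow> nat \<Rightarrow> nat \<Rightarrow> 'f::field falg" where
  "rootE m i 0 = 0"
| "rootE m i (Suc c) =
    (if c < i then 0
     else if c = i then gE i
     else rootE m i c * gE c - scal (inverse (qi m c)) * (gE c * rootE m i c))"

declare rootE.simps [simp del]

fun rootF :: "nat \<Rightarrow> nat \<Rightarrow> nat \<Rightarrow> 'f::field falg" where
  "rootF m i 0 = 0"
| "rootF m i (Suc c) =
    (if c < i then 0
     else if c = i then gF i
     else - scal (qi m c) * (rootF m i c * gF c) + gF c * rootF m i c)"

declare rootF.simps [simp del]

text \<open>The common parity of $E_{ij}$ and $F_{ij}$.\<close>
definition root_parity :: "nat \<Rightarrow> nat \<Rightarrow> nat \<Rightarrow> nat" where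
  "root_parity m i j = (if i \<le> m \<and> m < j then 1 else 0)"

text \<open>The supercommutator of \<open>x\<close> and \<open>y\<close>, homogeneous of parities \<open>a\<close> and \<open>b\<close>.\<close>
definition sbracket :: "nat \<Rightarrow> nat \<Rightarrow> 'f::field falg \<Rightarrow> 'f falg \<Rightarrow> 'f falg" where
  "sbracket a b x y = x * y - (-1) ^ (a * b) * (y * x)"

text \<open>A relation \<open>lhs = rhs\<close> is represented by \<open>lhs - rhs\<close>.\<close>

definition rels1 :: "nat \<Rightarrow> nat \<Rightarrow> 'f::field falg set" where
  "rels1 m n =
     {gK i * gK j - gK j * gK i | i j. i \<in> {1..m+n} \<and> j \<in> {1..m+n}}
   \<union> {gK i * gKinv i - 1 | i. i \<in> {1..m+n}}
   \<union> {gKinv i * gK i - 1 | i. i \<in> {1..m+n}}"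

definition wt :: "nat \<Rightarrow> nat \<Rightarrow> int" where
  "wt i j = of_bool (i = j) - of_bool (i = j + 1)"

definition rels2 :: "nat \<Rightarrow> nat \<Rightarrow> 'f::field falg set" where
  "rels2 m n =
     {gK i * gE j * gKinv i - scal (qi m i powi wt i j) * gE j
        | i j. i \<in> {1..m+n} \<and> j \<in> {1..<m+n}}
   \<union> {gK i * gF j * gKinv i - scal (qi m i powi (- wt i j)) * gF j
        | i j. i \<in> {1..m+n} \<and> j \<in> {1..<m+n}}"

definition rels3 :: "nat \<Rightarrow> nat \<Rightarrow> 'f::field falg set" where
  "rels3 m n =
     {sbracket (root_parity m i (i+1)) (root_parity m j (j+1)) (gE i) (gF j)
        - (if i = j
           then scal (inverse (qi m i - inverse (qi m i)))
                  * (gK i * gKinv (i+1) - gKinv i * gK (i+1))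
           else 0)
        | i j. i \<in> {1..<m+n} \<and> j \<in> {1..<m+n}}"

definition rels4 :: "nat \<Rightarrow> 'f::field falg set" where
  "rels4 m = {gE m ^ 2, gF m ^ 2}"

definition rels5 :: "nat \<Rightarrow> nat \<Rightarrow> 'f::field falg set" where
  "rels5 m n =
     {gE i * gE j - gE j * gE i
        | i j. i \<in> {1..<m+n} \<and> j \<in> {1..<m+n} \<and> \<bar>int i - int j\<bar> > 1}
   \<union> {gF i * gF j - gF j * gF i
        | i j. i \<in> {1..<m+n} \<and> j \<in> {1..<m+n} \<and> \<bar>int i - int j\<bar> > 1}"

definition serre :: "'f::field falg \<Rightarrow> 'f falg \<Rightarrow> 'f falg" where
  "serre x y = x ^ 2 * y - scal (qq + inverse qq) * (x * y * x) + y * x ^ 2"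

definition rels67 :: "nat \<Rightarrow> nat \<Rightarrow> 'f::field falg set" where
  "rels67 m n =
     {serre (gE i) (gE j)
        | i j. i \<in> {1..<m+n} \<and> j \<in> {1..<m+n} \<and> \<bar>int i - int j\<bar> = 1 \<and> i \<noteq> m}
   \<union> {serre (gF i) (gF j)
        | i j. i \<in> {1..<m+n} \<and> j \<in> {1..<m+n} \<and> \<bar>int i - int j\<bar> = 1 \<and> i \<noteq> m}"

text \<open>All indices in these two relations are in range exactly if $m, n \ge 2$.\<close>
definition rels8 :: "nat \<Rightarrow> nat \<Rightarrow> 'f::field falg set" where
  "rels8 m n =
    (if 2 \<le> m \<and> 2 \<le> n then
      {sbracket (root_parity m (m-1) (m+2)) (root_parity m m (m+1)) (rootE m (m-1) (m+2)) (gE m),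
       sbracket (root_parity m (m-1) (m+2)) (root_parity m m (m+1)) (rootF m (m-1) (m+2)) (gF m)}
     else {})"

definition uq_rels :: "nat \<Rightarrow> nat \<Rightarrow> 'f::field falg set" where
  "uq_rels m n = rels1 m n \<union> rels2 m n \<union> rels3 m n \<union> rels4 m \<union> rels5 m n \<union> rels67 m n \<union> rels8 m n"

section \<open>The algebra $U_q(\mathfrak{gl}(m,n))$\<close>

definition uq_ideal :: "nat \<Rightarrow> nat \<Rightarrow> 'f::field falg set" where
  "uq_ideal m n = genideal (free_alg m n) (uq_rels m n)"

definition Uq :: "nat \<Rightarrow> nat \<Rightarrow> 'f::field falg set ring" where
  "Uq m n = free_alg m n Quot uq_ideal m n"

text \<open>The class in $U_q$ of an element of the free algebra.\<close>
definition cls :: "nat \<Rightarrow> nat \<Rightarrow> 'f::field falg \<Rightarrow> 'f falg set" where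
  "cls m n x = uq_ideal m n +>\<^bsub>free_alg m n\<^esub> x"

inductive_set Uq_span :: "nat \<Rightarrow> nat \<Rightarrow> 'f::field falg set set \<Rightarrow> 'f falg set set"
  for m n :: nat and S :: "'f falg set set"
where
  zero: "\<zero>\<^bsub>Uq m n\<^esub> \<in> Uq_span m n S"
| base: "x \<in> S \<Longrightarrow> x \<in> Uq_span m n S"
| add: "x \<in> Uq_span m n S \<Longrightarrow> y \<in> Uq_span m n S \<Longrightarrow> x \<oplus>\<^bsub>Uq m n\<^esub> y \<in> Uq_span m n S"
| scale: "x \<in> Uq_span m n S \<Longrightarrow> cls m n (scal c) \<otimes>\<^bsub>Uq m n\<^esub> x \<in> Uq_span m n S"

text \<open>The $\mathbb F(q)$-subalgebra $U_q(\mathfrak g_{\bar 0})$: the subring generated by the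
  scalars and the algebra generators.\<close>
definition Uq_even :: "nat \<Rightarrow> nat \<Rightarrow> 'f::field falg set set" where
  "Uq_even m n = generate_ring (Uq m n) (cls m n `
     (range scal
      \<union> {gE i | i. i \<in> {1..<m+n} \<and> i \<noteq> m} \<union> {gF i | i. i \<in> {1..<m+n} \<and> i \<noteq> m}
      \<union> {gK j | j. j \<in> {1..m+n}} \<union> {gKinv j | j. j \<in> {1..m+n}}))"

text \<open>The set $\mathcal I_1$, listed in increasing lexicographic order.\<close>
definition odd_roots :: "nat \<Rightarrow> nat \<Rightarrow> (nat \<times> nat) list" where
  "odd_roots m n = List.product [1..<m+1] [m+1..<m+n+1]"

definition E1 :: "nat \<Rightarrow> nat \<Rightarrow> (nat \<times> nat \<Rightarrow> nat) \<Rightarrow> 'f::field falg" where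
  "E1 m n d = prod_list (map (\<lambda>(i, j). rootE m i j ^ d (i, j)) (odd_roots m n))"

definition N_plus :: "nat \<Rightarrow> nat \<Rightarrow> 'f::field falg set set" where
  "N_plus m n = Uq_span m n {cls m n (E1 m n d) | d. \<forall>p \<in> set (odd_roots m n). d p \<in> {0, 1}}"

fun swap_gen :: "uq_gen \<Rightarrow> uq_gen" where
  "swap_gen (GE i) = GF i"
| "swap_gen (GF i) = GE i"
| "swap_gen (GK j) = GKinv j"
| "swap_gen (GKinv j) = GK j"

definition Omega_free :: "'f::field falg \<Rightarrow> 'f falg" where
  "Omega_free x =
    (\<Sum>w \<in> Poly_Mapping.keys x.
       Poly_Mapping.single (rev (map swap_gen w)) (qbar (Poly_Mapping.lookup x w)))"

text \<open>The map induced by \<open>Omega_free\<close> on classes. That it is the anti-automorphism $\Omega$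
  with the prescribed values is shown in \<open>Omega_cls\<close> and the lemmas after it.\<close>
definition Omega :: "nat \<Rightarrow> nat \<Rightarrow> 'f::field falg set \<Rightarrow> 'f falg set" where
  "Omega m n X = (\<Union>x\<in>X. cls m n (Omega_free x))"

definition N_minus :: "nat \<Rightarrow> nat \<Rightarrow> 'f::field falg set set" where
  "N_minus m n = Omega m n ` N_plus m n"


section \<open>Well-definedness\<close>

subsection \<open>The automorphism \<open>qbar\<close>\<close>

lemma qconst_0 [simp]: "qconst 0 = 0"
  by (simp add: qconst_def fract_collapse)

lemma qconst_1 [simp]: "qconst 1 = 1"
  by (simp add: qconst_def fract_collapse flip: one_pCons)

lemma qconst_add: "qconst (a + b) = qconst a + qconst b"
  by (simp add: qconst_def)

lemma qconst_mult: "qconst (a * b) = qconst a * qconst b"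
  by (simp add: qconst_def mult.commute)

lemma qconst_eq_0 [simp]: "qconst a = 0 \<longleftrightarrow> a = 0"
  by (simp add: qconst_def Zero_fract_def eq_fract)

lemma qq_nonzero [simp]: "qq \<noteq> 0"
  by (simp add: qq_def Zero_fract_def eq_fract)

lemma map_poly_qconst_add: "map_poly qconst (p + r) = map_poly qconst p + map_poly qconst r"
  by (rule poly_eqI) (simp add: coeff_map_poly qconst_add)

lemma map_poly_qconst_smult: "map_poly qconst (Polynomial.smult a p) = Polynomial.smult (qconst a) (map_poly qconst p)"
  by (rule poly_eqI) (simp add: coeff_map_poly qconst_mult)

lemma map_poly_qconst_mult: "map_poly qconst (p * r) = map_poly qconst p * map_poly qconst r"
  by (induction p) (simp_all add: map_poly_qconst_add map_poly_qconst_smult map_poly_pCons)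

lemma eval_qinv_add: "eval_qinv (p + r) = eval_qinv p + eval_qinv r"
  by (simp add: eval_qinv_def map_poly_qconst_add)

lemma eval_qinv_mult: "eval_qinv (p * r) = eval_qinv p * eval_qinv r"
  by (simp add: eval_qinv_def map_poly_qconst_mult)

lemma poly_map_qconst_qq: "poly (map_poly qconst p) qq = Fract p 1"
proof (induction p)
  case 0 then show ?case by (simp add: fract_collapse)
next
  case (pCons a p)
  have "Fract (pCons a p) 1 = qconst a + qq * Fract p 1"
    by (simp add: qconst_def qq_def)
  with pCons show ?case by (simp add: map_poly_pCons)
qed

lemma eval_qinv_eq_0 [simp]: "eval_qinv p = 0 \<longleftrightarrow> p = 0"
proof
  assume "eval_qinv p = 0"
  then have "poly (reflect_poly (map_poly qconst p)) qq = 0"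
    by (simp add: poly_reflect_poly_nz eval_qinv_def)
  moreover have "reflect_poly (map_poly qconst p) = map_poly qconst (reflect_poly p)"
    by (rule poly_eqI) (simp add: coeff_reflect_poly coeff_map_poly degree_map_poly)
  ultimately have "Fract (reflect_poly p) 1 = 0"
    by (simp add: poly_map_qconst_qq)
  then show "p = 0" by (simp add: Zero_fract_def eq_fract)
qed (simp add: eval_qinv_def)

lemma rep_fract_Fract:
  assumes "rep_fract x = (a, b)" shows "b \<noteq> 0 \<and> x = Fract a b"
proof -
  have Q: "Quotient fractrel abs_fract rep_fract cr_fract"
    by (rule Quotient_fract)
  have *: "fractrel (rep_fract x) (rep_fract x)"
    using Quotient_rep_reflp[OF Q] by blast
  then have b: "b \<noteq> 0" using assms by simp
  have "x = abs_fract (rep_fract x)" by (rule Quotient_abs_rep[OF Q, symmetric])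
  also have "\<dots> = Fract a b" using b by (simp add: assms Fract.abs_eq)
  finally show ?thesis using b by simp
qed

lemma qbar_Fract:
  assumes "b \<noteq> 0" shows "qbar (Fract a b) = eval_qinv a / eval_qinv b"
proof -
  obtain c d where cd: "rep_fract (Fract a b) = (c, d)" by force
  from rep_fract_Fract[OF this] have d: "d \<noteq> 0" and "Fract a b = Fract c d" by auto
  with assms have "a * d = c * b" by (simp add: eq_fract)
  then have "eval_qinv a * eval_qinv d = eval_qinv c * eval_qinv b"
    by (metis eval_qinv_mult)
  then show ?thesis using d assms by (simp add: qbar_def cd field_simps)
qed

lemma qbar_add [simp]: "qbar (x + y) = qbar x + qbar y"
  by (cases x; cases y) (simp add: qbar_Fract eval_qinv_add eval_qinv_mult field_simps)

lemma qbar_mult [simp]: "qbar (x * y) = qbar x * qbar y"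
  by (cases x; cases y) (simp add: qbar_Fract eval_qinv_mult)

lemma qbar_qconst [simp]: "qbar (qconst a) = qconst a"
  unfolding qconst_def by (subst qbar_Fract) (simp_all add: eval_qinv_def map_poly_pCons qconst_def[symmetric])

lemma qbar_0 [simp]: "qbar 0 = 0"
  using qbar_qconst[of 0] by simp

lemma qbar_1 [simp]: "qbar 1 = 1"
  using qbar_qconst[of 1] by simp

lemma qbar_qq [simp]: "qbar qq = inverse qq"
  unfolding qq_def by (subst qbar_Fract) (simp_all add: eval_qinv_def map_poly_pCons qq_def[symmetric])

lemma qbar_uminus [simp]: "qbar (- x) = - qbar x"
  using qbar_add[of x "-x"] by (simp add: eq_neg_iff_add_eq_0 add.commute del: qbar_add)

lemma qbar_diff [simp]: "qbar (x - y) = qbar x - qbar y"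
  using qbar_add[of x "-y"] by simp

lemma qbar_eq_0 [simp]: "qbar x = 0 \<longleftrightarrow> x = 0"
proof
  assume "qbar x = 0"
  then show "x = 0" using qbar_mult[of x "inverse x"] by (cases "x = 0") auto
qed simp

lemma qbar_inverse [simp]: "qbar (inverse x) = inverse (qbar x)"
proof (cases "x = 0")
  case False
  then have "qbar x * qbar (inverse x) = 1" by (simp flip: qbar_mult)
  then show ?thesis by (metis inverse_unique)
qed simp

lemma qbar_eval_qinv: "qbar (eval_qinv p) = Fract p 1"
proof (induction p)
  case 0 then show ?case by (simp add: eval_qinv_def fract_collapse)
next
  case (pCons a p)
  have "Fract (pCons a p) 1 = qconst a + qq * Fract p 1"
    by (simp add: qconst_def qq_def)
  with pCons show ?case by (simp add: map_poly_pCons eval_qinv_def)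
qed

lemma qbar_qbar [simp]: "qbar (qbar x) = x"
  by (cases x) (simp add: qbar_Fract divide_inverse qbar_eval_qinv)

lemma qbar_power [simp]: "qbar (x ^ k) = qbar x ^ k"
  by (induction k) simp_all

lemma qbar_powi [simp]: "qbar (x powi k) = qbar x powi k"
  by (simp add: power_int_def)

lemma qbar_qi [simp]: "qbar (qi m i) = inverse (qi m i)"
  by (simp add: qi_def)

subsection \<open>The map \<open>Omega_free\<close>\<close>

lemma swap_gen_swap_gen [simp]: "swap_gen (swap_gen g) = g"
  by (cases g) auto

lemma gen_ok_swap_gen [simp]: "gen_ok m n (swap_gen g) = gen_ok m n g"
  by (cases g) auto

lemma swap_gen_comp [simp]: "swap_gen \<circ> swap_gen = id"
  by (simp add: fun_eq_iff)

lemma rev_swap_rev_swap [simp]: "rev (map swap_gen (rev (map swap_gen w))) = w"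
  by (simp add: rev_map)

lemma lookup_Omega_free:
  "Poly_Mapping.lookup (Omega_free x) w = qbar (Poly_Mapping.lookup x (rev (map swap_gen w)))"
proof -
  let ?r = "\<lambda>w. rev (map swap_gen w)"
  have eq: "?r v = w \<longleftrightarrow> v = ?r w" for v by (metis rev_swap_rev_swap)
  have "Poly_Mapping.lookup (Omega_free x) w =
        (\<Sum>v \<in> Poly_Mapping.keys x. if v = ?r w then qbar (Poly_Mapping.lookup x v) else 0)"
    unfolding Omega_free_def lookup_sum lookup_single when_def eq by simp
  also have "\<dots> = qbar (Poly_Mapping.lookup x (?r w))"
    by (simp add: sum.delta' sum.delta in_keys_iff)
  finally show ?thesis .
qed

lemma Omega_free_Omega_free [simp]: "Omega_free (Omega_free x) = x"
  by (rule poly_mapping_eqI) (simp add: lookup_Omega_free del: rev_map)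

lemma Omega_free_0 [simp]: "Omega_free 0 = 0"
  by (simp add: Omega_free_def)

lemma Omega_free_add [simp]: "Omega_free (x + y) = Omega_free x + Omega_free y"
  by (rule poly_mapping_eqI) (simp add: lookup_Omega_free lookup_add)

lemma Omega_free_uminus [simp]: "Omega_free (- x) = - Omega_free x"
  by (rule poly_mapping_eqI) (simp add: lookup_Omega_free)

lemma Omega_free_diff [simp]: "Omega_free (x - y) = Omega_free x - Omega_free y"
  by (rule poly_mapping_eqI) (simp add: lookup_Omega_free lookup_minus)

lemma Omega_free_sum: "Omega_free (sum f A) = (\<Sum>a\<in>A. Omega_free (f a))"
  by (induction A rule: infinite_finite_induct) simp_all

lemma Omega_free_single [simp]:
  "Omega_free (Poly_Mapping.single w c) = Poly_Mapping.single (rev (map swap_gen w)) (qbar c)"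
  by (cases "c = 0") (simp_all add: Omega_free_def)

lemma falg_sum_single:
  "x = (\<Sum>w \<in> Poly_Mapping.keys x. Poly_Mapping.single w (Poly_Mapping.lookup x w))"
  by (rule poly_mapping_eqI)
     (simp add: lookup_sum lookup_single when_def sum.delta' sum.delta in_keys_iff)

lemma Omega_free_mult [simp]: "Omega_free (x * y) = Omega_free y * Omega_free x"
proof -
  have *: "Omega_free (Poly_Mapping.single v c * Poly_Mapping.single w d)
      = Omega_free (Poly_Mapping.single w d) * Omega_free (Poly_Mapping.single v c)" for v w c d
    by (simp add: mult_single plus_list_def mult.commute)
  let ?s = "\<lambda>x w. Poly_Mapping.single w (Poly_Mapping.lookup x w)"
  have "Omega_free ((\<Sum>v\<in>Poly_Mapping.keys x. ?s x v) * (\<Sum>w\<in>Poly_Mapping.keys y. ?s y w))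
      = Omega_free (\<Sum>w\<in>Poly_Mapping.keys y. ?s y w) * Omega_free (\<Sum>v\<in>Poly_Mapping.keys x. ?s x v)"
    by (simp only: sum_product Omega_free_sum *) (rule sum.swap)
  then show ?thesis by (simp flip: falg_sum_single)
qed

lemma one_falg: "(1 :: 'f::field falg) = Poly_Mapping.single [] 1"
  by (simp flip: zero_list_def)

lemma Omega_free_scal [simp]: "Omega_free (scal c) = scal (qbar c)"
  by (simp add: scal_def)

lemma scal_1 [simp]: "scal 1 = 1"
  by (simp add: scal_def one_falg)

lemma scal_0 [simp]: "scal 0 = 0"
  by (simp add: scal_def)

lemma scal_uminus: "scal (- c) = - scal c"
  by (simp add: scal_def single_uminus)

lemma scal_mult: "scal (c * d) = scal c * scal d"
  by (simp add: scal_def mult_single plus_list_def)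

lemma Omega_free_1 [simp]: "Omega_free 1 = 1"
  using Omega_free_scal[of 1] by simp

lemma Omega_free_gen [simp]: "Omega_free (gen g) = gen (swap_gen g)"
  by (simp add: gen_def)

lemma scal_commute: "scal c * x = x * scal c"
proof -
  have "scal c * Poly_Mapping.single w d = Poly_Mapping.single w d * scal c" for w d
    by (simp add: scal_def mult_single plus_list_def mult.commute)
  then have "scal c * (\<Sum>w\<in>Poly_Mapping.keys x. Poly_Mapping.single w (Poly_Mapping.lookup x w))
     = (\<Sum>w\<in>Poly_Mapping.keys x. Poly_Mapping.single w (Poly_Mapping.lookup x w)) * scal c"
    by (simp add: sum_distrib_left sum_distrib_right)
  then show ?thesis by (simp flip: falg_sum_single)
qed

lemma Omega_free_rootE [simp]: "Omega_free (rootE m i j) = rootF m i j"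
proof (induction j)
  case 0 then show ?case by (simp add: rootE.simps rootF.simps)
next
  case (Suc c)
  then show ?case
    by (auto simp: rootE.simps(2) rootF.simps(2) scal_commute mult.assoc)
qed

lemma Omega_free_rootF [simp]: "Omega_free (rootF m i j) = rootE m i j"
  by (metis Omega_free_rootE Omega_free_Omega_free)

lemma scal_left:
  "NO_MATCH (scal d) x \<Longrightarrow> x * scal c = scal c * x"
  "NO_MATCH (scal d) x \<Longrightarrow> x * (scal c * y) = scal c * (x * y)"
proof -
  show *: "x * scal c = scal c * x" by (rule scal_commute[symmetric])
  show "x * (scal c * y) = scal c * (x * y)"
    using * by (simp flip: mult.assoc)
qed

subsection \<open>The quotient\<close>

lemma carrier_free_alg:
  "x \<in> carrier (free_alg m n) \<longleftrightarrow> (\<forall>w \<in> Poly_Mapping.keys x. \<forall>g \<in> set w. gen_ok m n g)"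
  by (simp add: free_alg_def)

lemma free_alg_simps [simp]:
  "monoid.mult (free_alg m n) = (*)" "one (free_alg m n) = 1"
  "zero (free_alg m n) = 0" "add (free_alg m n) = (+)"
  by (simp_all add: free_alg_def)

lemma fa_single:
  "(\<And>g. g \<in> set w \<Longrightarrow> gen_ok m n g) \<Longrightarrow> Poly_Mapping.single w c \<in> carrier (free_alg m n)"
  by (simp add: carrier_free_alg)

lemma fa_0 [simp]: "0 \<in> carrier (free_alg m n)"
  by (simp add: carrier_free_alg)

lemma fa_add [simp]:
  "x \<in> carrier (free_alg m n) \<Longrightarrow> y \<in> carrier (free_alg m n) \<Longrightarrow> x + y \<in> carrier (free_alg m n)"
  unfolding carrier_free_alg using Poly_Mapping.keys_add[of x y] by blast

lemma fa_uminus [simp]: "x \<in> carrier (free_alg m n) \<Longrightarrow> - x \<in> carrier (free_alg m n)"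
  by (simp add: carrier_free_alg)

lemma fa_diff [simp]:
  "x \<in> carrier (free_alg m n) \<Longrightarrow> y \<in> carrier (free_alg m n) \<Longrightarrow> x - y \<in> carrier (free_alg m n)"
  using fa_add[of x m n "- y"] by simp

lemma fa_mult [simp]:
  assumes "x \<in> carrier (free_alg m n)" "y \<in> carrier (free_alg m n)"
  shows "x * y \<in> carrier (free_alg m n)"
  unfolding carrier_free_alg
proof
  fix w assume "w \<in> Poly_Mapping.keys (x * y)"
  then obtain a b where "a \<in> Poly_Mapping.keys x" "b \<in> Poly_Mapping.keys y" "w = a + b"
    using keys_mult[of x y] by blast
  then show "\<forall>g \<in> set w. gen_ok m n g"
    using assms by (auto simp: carrier_free_alg plus_list_def)
qed

lemma fa_scal [simp]: "scal c \<in> carrier (free_alg m n)"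
  unfolding scal_def by (rule fa_single) simp

lemma fa_1 [simp]: "1 \<in> carrier (free_alg m n)"
  using fa_scal[of 1] by simp

lemma fa_gen [simp]: "gen_ok m n g \<Longrightarrow> gen g \<in> carrier (free_alg m n)"
  unfolding gen_def by (rule fa_single) simp

lemma fa_power [simp]: "x \<in> carrier (free_alg m n) \<Longrightarrow> x ^ k \<in> carrier (free_alg m n)"
  by (induction k) simp_all

lemma fa_Omega_free [simp]:
  "x \<in> carrier (free_alg m n) \<Longrightarrow> Omega_free x \<in> carrier (free_alg m n)"
  unfolding carrier_free_alg
proof
  fix w assume x: "\<forall>w\<in>Poly_Mapping.keys x. \<forall>g\<in>set w. gen_ok m n g"
    and w: "w \<in> Poly_Mapping.keys (Omega_free x)"
  from w have "rev (map swap_gen w) \<in> Poly_Mapping.keys x"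
    by (simp add: in_keys_iff lookup_Omega_free)
  with x have "\<forall>g\<in>set (rev (map swap_gen w)). gen_ok m n g" by blast
  then show "\<forall>g\<in>set w. gen_ok m n g" by simp
qed

lemma fa_rootE [simp]: "1 \<le> i \<Longrightarrow> j \<le> m + n \<Longrightarrow> rootE m i j \<in> carrier (free_alg m n)"
  by (induction j) (auto simp: rootE.simps)

lemma fa_rootF [simp]: "1 \<le> i \<Longrightarrow> j \<le> m + n \<Longrightarrow> rootF m i j \<in> carrier (free_alg m n)"
  by (induction j) (auto simp: rootF.simps)

lemma ring_free_alg: "ring (free_alg m n :: 'f::field falg ring)"
proof (rule ringI)
  show "abelian_group (free_alg m n :: 'f falg ring)"
  proof (rule abelian_groupI)
    fix x :: "'f falg" assume "x \<in> carrier (free_alg m n)"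
    then show "\<exists>y\<in>carrier (free_alg m n). y \<oplus>\<^bsub>free_alg m n\<^esub> x = \<zero>\<^bsub>free_alg m n\<^esub>"
      by (intro bexI[of _ "- x"]) auto
  qed (auto simp: add_ac)
  show "Group.monoid (free_alg m n :: 'f falg ring)"
    by (rule monoidI) (auto simp: mult.assoc)
qed (auto simp: algebra_simps)

lemma sbracket_closed [simp]:
  "x \<in> carrier (free_alg m n) \<Longrightarrow> y \<in> carrier (free_alg m n) \<Longrightarrow> sbracket a b x y \<in> carrier (free_alg m n)"
  by (simp add: sbracket_def)

lemma serre_closed [simp]:
  "x \<in> carrier (free_alg m n) \<Longrightarrow> y \<in> carrier (free_alg m n) \<Longrightarrow> serre x y \<in> carrier (free_alg m n)"
  by (simp add: serre_def)

lemma uq_rels_closed: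
  assumes "1 \<le> m" "1 \<le> n" shows "uq_rels m n \<subseteq> carrier (free_alg m n)"
  using assms
  by (auto simp: uq_rels_def rels1_def rels2_def rels3_def rels4_def rels5_def rels67_def rels8_def)

lemma uq_ideal_ideal:
  assumes "1 \<le> m" "1 \<le> n" shows "ideal (uq_ideal m n) (free_alg m n)"
  unfolding uq_ideal_def by (intro ring.genideal_ideal ring_free_alg uq_rels_closed assms)

lemma uq_rels_in_ideal: "x \<in> uq_rels m n \<Longrightarrow> x \<in> uq_ideal m n"
  by (auto simp: uq_ideal_def genideal_def)

context
  fixes m n :: nat
  assumes mn: "1 \<le> m" "1 \<le> n"
begin

lemma uq_ideal_carrier: "x \<in> uq_ideal m n \<Longrightarrow> x \<in> carrier (free_alg m n)"
  using ideal.Icarr[OF uq_ideal_ideal[OF mn]] .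

lemma uq_ideal_0: "0 \<in> uq_ideal m n"
  using additive_subgroup.zero_closed[OF ideal.axioms(1)[OF uq_ideal_ideal[OF mn]]] by simp

lemma uq_ideal_add: "x \<in> uq_ideal m n \<Longrightarrow> y \<in> uq_ideal m n \<Longrightarrow> x + y \<in> uq_ideal m n"
  using additive_subgroup.a_closed[OF ideal.axioms(1)[OF uq_ideal_ideal[OF mn]], of x y] by simp

lemma uq_ideal_lmult: "x \<in> uq_ideal m n \<Longrightarrow> y \<in> carrier (free_alg m n) \<Longrightarrow> y * x \<in> uq_ideal m n"
  using ideal.I_l_closed[OF uq_ideal_ideal[OF mn], of x y] by simp

lemma uq_ideal_rmult: "x \<in> uq_ideal m n \<Longrightarrow> y \<in> carrier (free_alg m n) \<Longrightarrow> x * y \<in> uq_ideal m n"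
  using ideal.I_r_closed[OF uq_ideal_ideal[OF mn], of x y] by simp

lemma uq_ideal_uminus: "x \<in> uq_ideal m n \<Longrightarrow> - x \<in> uq_ideal m n"
  using uq_ideal_lmult[of x "-1"] by simp

lemma uq_ideal_diff: "x \<in> uq_ideal m n \<Longrightarrow> y \<in> uq_ideal m n \<Longrightarrow> x - y \<in> uq_ideal m n"
  using uq_ideal_add[of x "-y"] uq_ideal_uminus[of y] by simp

lemma uq_idealI:
  assumes "ideal J (free_alg m n)" "uq_rels m n \<subseteq> J" shows "uq_ideal m n \<subseteq> J"
  using assms by (auto simp: uq_ideal_def genideal_def)

lemma cls_hom: "(cls m n :: 'f::field falg \<Rightarrow> _) \<in> ring_hom (free_alg m n) (Uq m n)"
proof -
  have "(cls m n :: 'f falg \<Rightarrow> _) = (+>\<^bsub>free_alg m n\<^esub>) (uq_ideal m n)"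
    by (simp add: fun_eq_iff cls_def)
  then show ?thesis
    unfolding Uq_def by (simp only:) (rule ideal.rcos_ring_hom[OF uq_ideal_ideal[OF mn]])
qed

lemma ring_Uq: "ring (Uq m n)"
  unfolding Uq_def by (rule ideal.quotient_is_ring[OF uq_ideal_ideal[OF mn]])

lemma carrier_Uq: "carrier (Uq m n) = cls m n ` carrier (free_alg m n)"
  by (auto simp: Uq_def FactRing_def A_RCOSETS_def' cls_def)

lemma cls_def': "cls m n x = {a + x | a. a \<in> uq_ideal m n}"
  by (auto simp: cls_def a_r_coset_def')

lemma cls_eq_iff: "cls m n x = cls m n y \<longleftrightarrow> x - y \<in> uq_ideal m n"
proof
  assume "cls m n x = cls m n y"
  moreover have "x \<in> cls m n x" unfolding cls_def' using uq_ideal_0 by force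
  ultimately obtain a where "a \<in> uq_ideal m n" "x = a + y" unfolding cls_def' by auto
  then show "x - y \<in> uq_ideal m n" by simp
next
  have *: "cls m n x \<subseteq> cls m n y" if "x - y \<in> uq_ideal m n" for x y
  proof
    fix z assume "z \<in> cls m n x"
    then obtain a where "a \<in> uq_ideal m n" "z = a + x" unfolding cls_def' by auto
    then show "z \<in> cls m n y" unfolding cls_def' using that uq_ideal_add[of a "x - y"]
      by (auto intro!: exI[of _ "a + (x - y)"])
  qed
  assume "x - y \<in> uq_ideal m n"
  then show "cls m n x = cls m n y"
    using *[of x y] *[of y x] uq_ideal_uminus[of "x - y"] by auto
qed

lemma cls_self: "x \<in> cls m n x"
  unfolding cls_def' using uq_ideal_0 by force

lemma cls_rel: "x - y \<in> uq_rels m n \<Longrightarrow> cls m n x = cls m n y"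
  by (simp add: cls_eq_iff uq_rels_in_ideal)

lemma cls_mult: "x \<in> carrier (free_alg m n) \<Longrightarrow> y \<in> carrier (free_alg m n) \<Longrightarrow>
    cls m n (x * y) = cls m n x \<otimes>\<^bsub>Uq m n\<^esub> cls m n y"
  using ring_hom_mult[OF cls_hom, of x y] by simp

lemma cls_add: "x \<in> carrier (free_alg m n) \<Longrightarrow> y \<in> carrier (free_alg m n) \<Longrightarrow>
    cls m n (x + y) = cls m n x \<oplus>\<^bsub>Uq m n\<^esub> cls m n y"
  using ring_hom_add[OF cls_hom, of x y] by simp

subsection \<open>Independence of $c$\<close>

lemma uq_ideal_EE:
  assumes "1 \<le> i" "i + 1 < j" "j < m + n"
  shows "gE i * gE j - gE j * gE i \<in> (uq_ideal m n :: 'f::field falg set)"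
proof -
  have "gE i * gE j - gE j * gE i \<in> (rels5 m n :: 'f falg set)"
    unfolding rels5_def using assms by (intro UnI1 CollectI exI[of _ i] exI[of _ j]) auto
  then show ?thesis by (intro uq_rels_in_ideal) (simp add: uq_rels_def)
qed

lemma uq_ideal_combine2:
  assumes "X \<in> uq_ideal m n" "Y \<in> uq_ideal m n"
    "x \<in> carrier (free_alg m n)" "y \<in> carrier (free_alg m n)"
  shows "x * Y + X * y - scal a * (y * X + Y * x) \<in> uq_ideal m n"
  by (intro uq_ideal_diff uq_ideal_add uq_ideal_lmult[of "_ + _" "scal _"]
      uq_ideal_lmult[OF assms(1)] uq_ideal_lmult[OF assms(2)]
      uq_ideal_rmult[OF assms(1)] uq_ideal_rmult[OF assms(2)] assms fa_scal)

lemma uq_ideal_rootE_E: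
  assumes "1 \<le> i" "c < j" "j < m + n"
  shows "rootE m i c * gE j - gE j * rootE m i c \<in> (uq_ideal m n :: 'f::field falg set)"
  using assms
proof (induction c)
  case 0 then show ?case by (simp add: rootE.simps uq_ideal_0)
next
  case (Suc c)
  consider "c < i" | "c = i" | "i < c" by linarith
  then show ?case
  proof cases
    case 1 then show ?thesis by (simp add: rootE.simps uq_ideal_0)
  next
    case 2 then show ?thesis using Suc.prems uq_ideal_EE[of i j] by (simp add: rootE.simps)
  next
    case 3
    let ?x = "rootE m i c :: 'f falg" and ?y = "gE c :: 'f falg" and ?z = "gE j :: 'f falg" and ?s = "scal (inverse (qi m c)) :: 'f falg"
    have carr: "?x \<in> carrier (free_alg m n :: 'f falg ring)" "?y \<in> carrier (free_alg m n :: 'f falg ring)"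
        "?z \<in> carrier (free_alg m n :: 'f falg ring)"
      using Suc.prems 3 by auto
    have x: "?x * ?z - ?z * ?x \<in> (uq_ideal m n :: 'f falg set)" using Suc by simp
    have y: "?y * ?z - ?z * ?y \<in> (uq_ideal m n :: 'f falg set)" using Suc.prems 3 uq_ideal_EE[of c j] by simp
    have "?x * (?y * ?z - ?z * ?y) + (?x * ?z - ?z * ?x) * ?y
        - ?s * (?y * (?x * ?z - ?z * ?x) + (?y * ?z - ?z * ?y) * ?x) \<in> (uq_ideal m n :: 'f falg set)"
      by (rule uq_ideal_combine2[OF x y carr(1,2)])
    then show ?thesis using 3 by (simp add: rootE.simps algebra_simps scal_left)
  qed
qed

lemma uq_ideal_combine:
  assumes "D \<in> uq_ideal m n" "X \<in> uq_ideal m n"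
    "y \<in> carrier (free_alg m n)" "z \<in> carrier (free_alg m n)"
  shows "D * z - scal a * (z * D) + scal a * (X * y) - scal b * (y * X) \<in> uq_ideal m n"
  by (intro uq_ideal_diff uq_ideal_add uq_ideal_lmult[of "_ * _" "scal _"]
      uq_ideal_lmult[OF assms(1)] uq_ideal_lmult[OF assms(2)]
      uq_ideal_rmult[OF assms(1)] uq_ideal_rmult[OF assms(2)] assms fa_scal)

lemma rootE_split:
  assumes "1 \<le> i" "i < c" "c < j" "j \<le> m + n"
  shows "cls m n (rootE m i j :: 'f::field falg) = cls m n (rootE m i c * rootE m c j
           - scal (inverse (qi m c)) * (rootE m c j * rootE m i c))"
  unfolding cls_eq_iff using assms
proof (induction j)
  case (Suc j)
  show ?case
  proof (cases "c = j")
    case True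
    with Suc.prems show ?thesis by (simp add: rootE.simps uq_ideal_0)
  next
    case False
    then have cj: "c < j" using Suc.prems by simp
    let ?x = "rootE m i c :: 'f falg" and ?y = "rootE m c j :: 'f falg" and ?z = "gE j :: 'f falg" and ?w = "rootE m i j :: 'f falg"
      and ?s = "scal (inverse (qi m j)) :: 'f falg" and ?t = "scal (inverse (qi m c)) :: 'f falg"
    have carr: "?x \<in> carrier (free_alg m n :: 'f falg ring)" "?y \<in> carrier (free_alg m n :: 'f falg ring)"
        "?z \<in> carrier (free_alg m n :: 'f falg ring)"
      using Suc.prems cj by auto
    have xz: "?x * ?z - ?z * ?x \<in> (uq_ideal m n :: 'f falg set)"
      using Suc.prems cj uq_ideal_rootE_E[of i c j] by simp
    have w: "?w - (?x * ?y - ?t * (?y * ?x)) \<in> (uq_ideal m n :: 'f falg set)" using Suc cj by simp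
    have "(?w - (?x * ?y - ?t * (?y * ?x))) * ?z - ?s * (?z * (?w - (?x * ?y - ?t * (?y * ?x))))
       + ?s * ((?x * ?z - ?z * ?x) * ?y) - ?t * (?y * (?x * ?z - ?z * ?x)) \<in> (uq_ideal m n :: 'f falg set)"
      by (rule uq_ideal_combine[OF w xz carr(2,3)])
    moreover have "?s * (?t * a) = ?t * (?s * a)" for a
    proof -
      have "?s * ?t = ?t * ?s" by (rule scal_commute)
      then show ?thesis by (simp flip: mult.assoc)
    qed
    ultimately show ?thesis using cj Suc.prems by (simp add: rootE.simps algebra_simps scal_left)
  qed
qed simp

subsection \<open>\<open>Omega\<close> is well defined\<close>

lemma rels1_in_ideal: "x \<in> rels1 m n \<Longrightarrow> x \<in> uq_ideal m n"
  by (intro uq_rels_in_ideal) (simp add: uq_rels_def)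

lemma K_Kinv_ideal:
  assumes "i \<in> {1..m+n}"
  shows "gK i * gKinv i - 1 \<in> uq_ideal m n" "gKinv i * gK i - 1 \<in> uq_ideal m n"
  by (rule rels1_in_ideal; unfold rels1_def; use assms in blast)+

lemma K_K_ideal:
  assumes "i \<in> {1..m+n}" "j \<in> {1..m+n}"
  shows "gK i * gK j - gK j * gK i \<in> uq_ideal m n"
  by (rule rels1_in_ideal, unfold rels1_def) (use assms in blast)

lemma commute_inverse_ideal:
  assumes "a * b - 1 \<in> uq_ideal m n" "b * a - 1 \<in> uq_ideal m n" "x * a - a * x \<in> uq_ideal m n"
    "a \<in> carrier (free_alg m n)" "b \<in> carrier (free_alg m n)" "x \<in> carrier (free_alg m n)"
  shows "x * b - b * x \<in> uq_ideal m n"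
proof -
  have "b * (x * a - a * x) * b + (b * a - 1) * (x * b) - b * x * (a * b - 1) \<in> uq_ideal m n"
    by (rule uq_ideal_diff[OF uq_ideal_add[OF uq_ideal_rmult[OF uq_ideal_lmult]
          uq_ideal_rmult] uq_ideal_lmult]) (simp_all add: assms)
  then show ?thesis using uq_ideal_uminus[of "b * x - x * b"] by (simp add: algebra_simps)
qed

lemma K_Kinv_commute:
  assumes "i \<in> {1..m+n}" "j \<in> {1..m+n}"
  shows "gK i * gKinv j - gKinv j * gK i \<in> uq_ideal m n"
  using assms
  by (intro commute_inverse_ideal[OF K_Kinv_ideal[OF assms(2)] K_K_ideal[OF assms]]) auto

lemma Kinv_Kinv_commute:
  assumes "i \<in> {1..m+n}" "j \<in> {1..m+n}"
  shows "gKinv i * gKinv j - gKinv j * gKinv i \<in> uq_ideal m n"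
proof -
  have "gKinv i * gK j - gK j * gKinv i \<in> uq_ideal m n"
    using uq_ideal_uminus[OF K_Kinv_commute[OF assms(2,1)]] by simp
  from commute_inverse_ideal[OF K_Kinv_ideal[OF assms(2)] this] show ?thesis
    using assms by auto
qed

lemma Omega_free_sbracket [simp]:
  "Omega_free (sbracket a b x y) = sbracket b a (Omega_free y) (Omega_free x)"
proof -
  have "Omega_free (sbracket a b x y) =
     Omega_free y * Omega_free x - (-1) ^ (a * b) * (Omega_free x * Omega_free y)"
    by (cases "even (a * b)") (simp_all add: sbracket_def)
  then show ?thesis by (simp add: sbracket_def mult.commute[of a b])
qed

lemma Omega_free_power [simp]: "Omega_free (x ^ k) = Omega_free x ^ k"
  by (induction k) (simp_all add: power_commutes)

lemma Omega_free_serre [simp]: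
  "Omega_free (serre x y) = serre (Omega_free x) (Omega_free y)"
  by (simp add: serre_def mult.assoc scal_left add.commute)

lemma Omega_free_rels:
  fixes x :: "'f::field falg"
  assumes "x \<in> uq_rels m n" shows "Omega_free x \<in> uq_ideal m n"
proof -
  consider "x \<in> rels1 m n" | "x \<in> rels2 m n" | "x \<in> rels3 m n" | "x \<in> rels4 m" | "x \<in> rels5 m n"
    | "x \<in> rels67 m n" | "x \<in> rels8 m n"
    using assms by (auto simp: uq_rels_def)
  then show ?thesis
  proof cases
    case 1
    then consider (a) i j where "x = gK i * gK j - gK j * gK i" "i \<in> {1..m+n}" "j \<in> {1..m+n}"
      | (b) i where "x = gK i * gKinv i - 1" "i \<in> {1..m+n}"
      | (c) i where "x = gKinv i * gK i - 1" "i \<in> {1..m+n}"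
      unfolding rels1_def by blast
    then show ?thesis
    proof cases
      case a then show ?thesis using Kinv_Kinv_commute[of j i] by simp
    next
      case b then show ?thesis using K_Kinv_ideal[of i] by simp
    next
      case c then show ?thesis using K_Kinv_ideal[of i] by simp
    qed
  next
    case 2
    then consider (a) i j where "x = gK i * gE j * gKinv i - scal (qi m i powi wt i j) * gE j"
          "i \<in> {1..m+n}" "j \<in> {1..<m+n}"
      | (b) i j where "x = gK i * gF j * gKinv i - scal (qi m i powi (- wt i j)) * gF j"
          "i \<in> {1..m+n}" "j \<in> {1..<m+n}"
      unfolding rels2_def by blast
    then have "Omega_free x \<in> rels2 m n"
    proof cases
      case a
      have "Omega_free x = gK i * gF j * gKinv i - scal (qi m i powi (- wt i j)) * gF j"
        by (simp add: a scal_left mult.assoc power_int_minus power_int_inverse)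
      with a show ?thesis unfolding rels2_def by blast
    next
      case b
      have "Omega_free x = gK i * gE j * gKinv i - scal (qi m i powi wt i j) * gE j"
        by (simp add: b scal_left mult.assoc power_int_minus power_int_inverse)
      with b show ?thesis unfolding rels2_def by blast
    qed
    then show ?thesis by (intro uq_rels_in_ideal) (simp add: uq_rels_def)
  next
    case 3
    then obtain i j where ij: "i \<in> {1..<m+n}" "j \<in> {1..<m+n}"
      and x: "x = sbracket (root_parity m i (i+1)) (root_parity m j (j+1)) (gE i) (gF j)
        - (if i = j
           then scal (inverse (qi m i - inverse (qi m i)))
                  * (gK i * gKinv (i+1) - gKinv i * gK (i+1))
           else 0)"
      unfolding rels3_def by blast
    let ?y = "sbracket (root_parity m j (j+1)) (root_parity m i (i+1)) (gE j) (gF i :: 'f falg)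
        - (if j = i
           then scal (inverse (qi m j - inverse (qi m j)))
                  * (gK j * gKinv (j+1) - gKinv j * gK (j+1))
           else 0)"
    have y: "?y \<in> uq_ideal m n"
    proof -
      have "?y \<in> rels3 m n" unfolding rels3_def using ij by blast
      then show ?thesis by (intro uq_rels_in_ideal) (unfold uq_rels_def, blast)
    qed
    show ?thesis
    proof (cases "i = j")
      case False
      then show ?thesis using y by (simp add: x)
    next
      case True
      let ?s = "scal (inverse (qi m i - inverse (qi m i))) :: 'f falg"
      have s: "inverse (inverse (qi m i) - qi m i :: 'f ratfun) = - inverse (qi m i - inverse (qi m i))"
        by (metis inverse_minus_eq minus_diff_eq)
      have "(gK i * gKinv (i+1) - gKinv (i+1) * gK i) \<in> (uq_ideal m n :: 'f falg set)"
        "(gK (i+1) * gKinv i - gKinv i * gK (i+1)) \<in> (uq_ideal m n :: 'f falg set)"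
        using ij K_Kinv_commute[of i "i+1"] K_Kinv_commute[of "i+1" i] by auto
      then have *: "?y + ?s * ((gK i * gKinv (i+1) - gKinv (i+1) * gK i)
            + (gK (i+1) * gKinv i - gKinv i * gK (i+1))) \<in> uq_ideal m n"
        by (intro uq_ideal_add uq_ideal_lmult y fa_scal)
      have "Omega_free x = sbracket (root_parity m i (i+1)) (root_parity m i (i+1)) (gE i) (gF i)
          - (gK (i+1) * gKinv i - gKinv (i+1) * gK i) * scal (inverse (inverse (qi m i) - qi m i))"
        by (simp add: x True)
      also have "\<dots> = ?y + ?s * ((gK i * gKinv (i+1) - gKinv (i+1) * gK i)
            + (gK (i+1) * gKinv i - gKinv i * gK (i+1)))"
        unfolding s scal_uminus scal_commute[symmetric] mult_minus_right
        by (simp add: True algebra_simps scal_left)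
      finally show ?thesis using * by simp
    qed
  next
    case 4
    then have "Omega_free x \<in> rels4 m" by (auto simp: rels4_def)
    then show ?thesis by (intro uq_rels_in_ideal) (simp add: uq_rels_def)
  next
    case 5
    then consider (a) i j where "x = gE i * gE j - gE j * gE i"
          "i \<in> {1..<m+n}" "j \<in> {1..<m+n}" "\<bar>int j - int i\<bar> > 1"
      | (b) i j where "x = gF i * gF j - gF j * gF i"
          "i \<in> {1..<m+n}" "j \<in> {1..<m+n}" "\<bar>int j - int i\<bar> > 1"
      unfolding rels5_def by (auto simp: abs_minus_commute)
    then have "Omega_free x \<in> rels5 m n"
    proof cases
      case a
      then have "Omega_free x = gF j * gF i - gF i * gF j" by simp
      with a show ?thesis unfolding rels5_def by blast
    next
      case b
      then have "Omega_free x = gE j * gE i - gE i * gE j" by simp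
      with b show ?thesis unfolding rels5_def by blast
    qed
    then show ?thesis by (intro uq_rels_in_ideal) (simp add: uq_rels_def)
  next
    case 6
    then consider (a) i j where "x = serre (gE i) (gE j)"
          "i \<in> {1..<m+n}" "j \<in> {1..<m+n}" "\<bar>int i - int j\<bar> = 1" "i \<noteq> m"
      | (b) i j where "x = serre (gF i) (gF j)"
          "i \<in> {1..<m+n}" "j \<in> {1..<m+n}" "\<bar>int i - int j\<bar> = 1" "i \<noteq> m"
      unfolding rels67_def by blast
    then have "Omega_free x \<in> rels67 m n"
    proof cases
      case a
      then have "Omega_free x = serre (gF i) (gF j)" by simp
      with a show ?thesis unfolding rels67_def by blast
    next
      case b
      then have "Omega_free x = serre (gE i) (gE j)" by simp
      with b show ?thesis unfolding rels67_def by blast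
    qed
    then show ?thesis by (intro uq_rels_in_ideal) (simp add: uq_rels_def)
  next
    case 7
    then have "Omega_free x \<in> rels8 m n"
      unfolding rels8_def by (auto simp: sbracket_def root_parity_def add.commute split: if_splits)
    then show ?thesis by (intro uq_rels_in_ideal) (simp add: uq_rels_def)
  qed
qed

lemma Omega_free_ideal:
  fixes x :: "'f::field falg"
  assumes "x \<in> uq_ideal m n" shows "Omega_free x \<in> uq_ideal m n"
proof -
  let ?J = "{x \<in> carrier (free_alg m n). Omega_free x \<in> (uq_ideal m n :: 'f falg set)}"
  have grp: "Group.group (add_monoid (free_alg m n :: 'f falg ring))"
    using abelian_group.a_group[OF ring.is_abelian_group[OF ring_free_alg]] .
  have inv: "inv\<^bsub>add_monoid (free_alg m n)\<^esub> a = - a" if "a \<in> ?J" for a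
    by (rule group.inv_equality[OF grp]) (use that in auto)
  have "subgroup ?J (add_monoid (free_alg m n))"
  proof (rule group.subgroupI[OF grp])
    show "?J \<noteq> {}" using fa_0 uq_ideal_0 Omega_free_0 by fastforce
    fix a assume a: "a \<in> ?J"
    then show "inv\<^bsub>add_monoid (free_alg m n)\<^esub> a \<in> ?J"
      unfolding inv[OF a] using uq_ideal_uminus[of "Omega_free a"] by simp
  next
    fix a b assume "a \<in> ?J" "b \<in> ?J"
    then show "a \<otimes>\<^bsub>add_monoid (free_alg m n)\<^esub> b \<in> ?J" by (simp add: uq_ideal_add)
  qed auto
  then have "ideal ?J (free_alg m n)"
    by (intro idealI ring_free_alg) (auto intro: uq_ideal_lmult uq_ideal_rmult)
  moreover have "uq_rels m n \<subseteq> ?J" using Omega_free_rels uq_rels_closed[OF mn] by auto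
  ultimately have "uq_ideal m n \<subseteq> ?J" by (rule uq_idealI)
  with assms show ?thesis by auto
qed

lemma Omega_cls: "Omega m n (cls m n x) = cls m n (Omega_free x)"
proof -
  have "cls m n (Omega_free y) = cls m n (Omega_free x)" if "y \<in> cls m n x" for y
  proof -
    from that obtain a where "a \<in> uq_ideal m n" "y = a + x" unfolding cls_def' by auto
    then show ?thesis by (simp add: cls_eq_iff Omega_free_ideal)
  qed
  then show ?thesis unfolding Omega_def using cls_self[of x] by (intro equalityI UN_least) (metis subset_refl, blast)
qed

lemma Omega_closed: "X \<in> carrier (Uq m n) \<Longrightarrow> Omega m n X \<in> carrier (Uq m n)"
  unfolding carrier_Uq by (elim imageE) (simp add: Omega_cls)

lemma Omega_Omega: "X \<in> carrier (Uq m n) \<Longrightarrow> Omega m n (Omega m n X) = X"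
  unfolding carrier_Uq by (elim imageE) (simp add: Omega_cls)

lemma bij_Omega: "bij_betw (Omega m n) (carrier (Uq m n)) (carrier (Uq m n))"
  by (rule bij_betwI[where g = "Omega m n"]) (simp_all add: Omega_closed Omega_Omega)

lemma Omega_add:
  assumes "X \<in> carrier (Uq m n)" "Y \<in> carrier (Uq m n)"
  shows "Omega m n (X \<oplus>\<^bsub>Uq m n\<^esub> Y) = Omega m n X \<oplus>\<^bsub>Uq m n\<^esub> Omega m n Y"
proof -
  from assms obtain x y where xy: "x \<in> carrier (free_alg m n)" "y \<in> carrier (free_alg m n)"
    and XY: "X = cls m n x" "Y = cls m n y" unfolding carrier_Uq by blast
  show ?thesis unfolding XY cls_add[OF xy, symmetric] Omega_cls Omega_free_add
    by (rule cls_add[OF fa_Omega_free[OF xy(1)] fa_Omega_free[OF xy(2)]])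
qed

lemma Omega_mult:
  assumes "X \<in> carrier (Uq m n)" "Y \<in> carrier (Uq m n)"
  shows "Omega m n (X \<otimes>\<^bsub>Uq m n\<^esub> Y) = Omega m n Y \<otimes>\<^bsub>Uq m n\<^esub> Omega m n X"
proof -
  from assms obtain x y where xy: "x \<in> carrier (free_alg m n)" "y \<in> carrier (free_alg m n)"
    and XY: "X = cls m n x" "Y = cls m n y" unfolding carrier_Uq by blast
  show ?thesis unfolding XY cls_mult[OF xy, symmetric] Omega_cls Omega_free_mult
    by (rule cls_mult[OF fa_Omega_free[OF xy(2)] fa_Omega_free[OF xy(1)]])
qed

lemma Omega_values:
  "Omega m n (cls m n (gE i)) = cls m n (gF i)"
  "Omega m n (cls m n (gF i)) = cls m n (gE i)"
  "Omega m n (cls m n (gK j)) = cls m n (gKinv j)"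
  "Omega m n (cls m n (scal (qconst a))) = cls m n (scal (qconst a))"
  "Omega m n (cls m n (scal qq)) = cls m n (scal (inverse qq))"
  "Omega m n (cls m n (rootE m i j)) = cls m n (rootF m i j)"
  by (simp_all add: Omega_cls)

lemma rootF_split:
  assumes "1 \<le> i" "i < c" "c < j" "j \<le> m + n"
  shows "cls m n (rootF m i j :: 'f::field falg) = cls m n (- scal (qi m c) * (rootF m i c * rootF m c j)
           + rootF m c j * rootF m i c)"
proof -
  have "cls m n (rootF m i j :: 'f falg) = Omega m n (cls m n (rootE m i j))" by (simp add: Omega_cls)
  also have "\<dots> = cls m n (- scal (qi m c) * (rootF m i c * rootF m c j)
           + rootF m c j * rootF m i c)"
    unfolding rootE_split[OF assms] Omega_cls
    by (simp add: scal_left mult.assoc)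
  finally show ?thesis .
qed

end

end

theory Submission
  imports Defs "HOL-Library.Product_Lexorder"
begin

text \<open>By the relations (R2), (R3), $U_q$ is spanned by products of a word in the $F_{i,i+1}$, one in
  the $K_j^{\pm 1}$ and one in the $E_{i,i+1}$. For $i \ne m$ the span of the odd root vectors is
  stable, up to even factors moved to the left, under commutation with $E_{i,i+1}$, so a word in the
  $E_{i,i+1}$ is a combination of products of an even word and a word in odd root vectors. The odd
  root vectors satisfy quadratic relations, as in a quantum exterior algebra, which straighten the
  latter into the $E_1^d$. Applying $\Omega$ treats the words in the $F_{i,i+1}$.\<close>

text \<open>The relations contain only two facts about odd root vectors, $E_{m,m+1}^2 = 0$ and (R8),
  whereas straightening needs one for every pair of roots. Commutation with an even root vector
  moves one end of a root; applied to a known quadratic relation it produces the next. Moving the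
  same end in both factors of a square yields $(1 + q^2) y^2 = 0$ up to a unit, and $1 + q^2$ is
  invertible because $q$ is an indeterminate. That a move affects only the intended factor rests on
  disjointness of the roots or on the fact that $E_{i,i+1}$, $i$ different from $m$, commutes with
  every $E_{kj}$ where $k < i$ and $i + 1 < j$; this follows from the Serre relations, again after
  division by $1 + q^2$ or $1 + q^{-2}$. In the end the even letters split off from the F-word, the
  K-word, and the even letters split off from the E-word stand side by side and form a single even
  word in the middle.\<close>

section \<open>Projection onto words with admissible letters\<close>

definition word_ok :: "nat \<Rightarrow> nat \<Rightarrow> uq_gen list \<Rightarrow> bool" where
  "word_ok m n w \<longleftrightarrow> (\<forall>g \<in> set w. gen_ok m n g)"

text \<open>The type \<open>falg\<close> also contains words with out-of-range indices. This
  projection discards them; its kernel is spanned by the words with an inadmissible letter.\<close>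

definition ok_part :: "nat \<Rightarrow> nat \<Rightarrow> 'f::field falg \<Rightarrow> 'f falg" where
  "ok_part m n x = (\<Sum>w | w \<in> Poly_Mapping.keys x \<and> word_ok m n w.
     Poly_Mapping.single w (Poly_Mapping.lookup x w))"

lemma lookup_ok_part:
  "Poly_Mapping.lookup (ok_part m n x) w = (if word_ok m n w then Poly_Mapping.lookup x w else 0)"
  unfolding ok_part_def lookup_sum lookup_single when_def
  by (simp add: sum.delta' sum.delta in_keys_iff)

lemma ok_part_closed [simp]: "ok_part m n x \<in> carrier (free_alg m n)"
  unfolding carrier_free_alg by (auto simp: in_keys_iff lookup_ok_part word_ok_def split: if_splits)

lemma ok_part_id: "x \<in> carrier (free_alg m n) \<Longrightarrow> ok_part m n x = x"
  by (rule poly_mapping_eqI) (auto simp: lookup_ok_part carrier_free_alg word_ok_def in_keys_iff)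

lemma ok_part_0 [simp]: "ok_part m n 0 = 0"
  by (simp add: ok_part_def)

lemma ok_part_add [simp]: "ok_part m n (x + y) = ok_part m n x + ok_part m n y"
  by (rule poly_mapping_eqI) (simp add: lookup_ok_part lookup_add)

lemma ok_part_uminus [simp]: "ok_part m n (- x) = - ok_part m n x"
  by (rule poly_mapping_eqI) (simp add: lookup_ok_part)

lemma ok_part_diff [simp]: "ok_part m n (x - y) = ok_part m n x - ok_part m n y"
  by (rule poly_mapping_eqI) (simp add: lookup_ok_part lookup_minus)

lemma ok_part_sum: "ok_part m n (sum f A) = (\<Sum>a\<in>A. ok_part m n (f a))"
  by (induction A rule: infinite_finite_induct) simp_all

lemma ok_part_single:
  "ok_part m n (Poly_Mapping.single w c) = (if word_ok m n w then Poly_Mapping.single w c else 0)"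
  by (rule poly_mapping_eqI) (auto simp: lookup_ok_part lookup_single when_def)

text \<open>A concatenation is admissible exactly when both parts are, so the projection respects
  products.\<close>

lemma ok_part_mult [simp]: "ok_part m n (x * y) = ok_part m n x * ok_part m n y"
proof -
  have *: "ok_part m n (Poly_Mapping.single v c * Poly_Mapping.single w d)
      = ok_part m n (Poly_Mapping.single v c) * ok_part m n (Poly_Mapping.single w d)" for v w c d
    by (auto simp: mult_single plus_list_def ok_part_single word_ok_def)
  let ?s = "\<lambda>x w. Poly_Mapping.single w (Poly_Mapping.lookup x w)"
  have "ok_part m n ((\<Sum>v\<in>Poly_Mapping.keys x. ?s x v) * (\<Sum>w\<in>Poly_Mapping.keys y. ?s y w))
      = ok_part m n (\<Sum>v\<in>Poly_Mapping.keys x. ?s x v) * ok_part m n (\<Sum>w\<in>Poly_Mapping.keys y. ?s y w)"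
    by (simp only: sum_product ok_part_sum *)
  then show ?thesis by (simp flip: falg_sum_single)
qed

lemma ok_part_scal [simp]: "ok_part m n (scal c) = scal c"
  by (simp add: ok_part_id)

lemma word_ok_rev_swap [simp]: "word_ok m n (rev (map swap_gen w)) = word_ok m n w"
  by (simp add: word_ok_def)

lemma ok_part_Omega_free: "ok_part m n (Omega_free x) = Omega_free (ok_part m n x)"
  by (rule poly_mapping_eqI) (simp add: lookup_ok_part lookup_Omega_free del: rev_map)

text \<open>Through \<open>ok_part\<close> the ideal of relations becomes an ideal of the whole type of the free
  algebra, with the same quotient, so that no carrier conditions remain.\<close>
definition uq_null :: "nat \<Rightarrow> nat \<Rightarrow> 'f::field falg set" where
  "uq_null m n = {x. ok_part m n x \<in> uq_ideal m n}"

definition mon :: "uq_gen list \<Rightarrow> 'f::field falg" where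
  "mon w = Poly_Mapping.single w 1"

lemma mon_Nil [simp]: "mon [] = 1"
  by (simp add: mon_def one_falg)

lemma mon_append [simp]: "mon (v @ w) = mon v * mon w"
  by (simp add: mon_def mult_single plus_list_def)

lemma mon_Cons: "mon (g # w) = gen g * mon w"
  by (simp add: mon_def gen_def mult_single plus_list_def)

lemma Omega_free_mon: "Omega_free (mon w) = mon (rev (map swap_gen w))"
  by (simp add: mon_def)

lemma scal_scal: "scal c * (scal d * x) = scal (c * d) * x"
  by (simp add: scal_mult mult.assoc)

lemma scal_add: "scal (c + d) = scal c + scal d"
  by (simp add: scal_def single_add)

lemma scal_diff: "scal (c - d) = scal c - scal d"
  by (simp add: scal_def single_diff)

section \<open>Identities for the Serre polynomial in the free algebra\<close>

text \<open>With $L$, $R$ the left and right multiplication by \<open>x\<close>, the Serre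
  polynomial is $(R - p^{-1} L)(R - p L)$ applied to \<open>y\<close>. So a Serre relation says that
  a second commutator, with the inverse twist, vanishes.\<close>

lemma serre_twist_right:
  fixes x y :: "'f::field falg"
  assumes "p = qq \<or> p = inverse qq"
  shows "(y * x - scal p * (x * y)) * x - scal (inverse p) * (x * (y * x - scal p * (x * y))) = serre x y"
  using assms
  by (auto simp: serre_def algebra_simps scal_left scal_scal scal_add power2_eq_square)

lemma serre_twist_left:
  fixes x y :: "'f::field falg"
  assumes "p = qq \<or> p = inverse qq"
  shows "x * (x * y - scal p * (y * x)) - scal (inverse p) * ((x * y - scal p * (y * x)) * x) = serre x y"
  using assms
  by (auto simp: serre_def algebra_simps scal_left scal_scal scal_add power2_eq_square)

text \<open>Multiplication by an element commuting with \<open>x\<close> passes through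
  \<open>serre x\<close>. The identity displays the error as multiples of the commutator of
  \<open>x\<close> and \<open>u\<close>, to be read modulo the relations.\<close>

lemma serre_mult_left:
  "serre x (u * y) = u * serre x y + (x * (x * u - u * x) + (x * u - u * x) * x) * y
     - scal (qq + inverse qq) * ((x * u - u * x) * (y * x))"
  by (simp add: serre_def algebra_simps scal_left power2_eq_square)

lemma serre_mult_right:
  "serre x (y * u) = serre x y * u - y * (x * (x * u - u * x) + (x * u - u * x) * x)
     + scal (qq + inverse qq) * (x * y * (x * u - u * x))"
  by (simp add: serre_def algebra_simps scal_left power2_eq_square)

lemma serre_diff: "serre x (y - z) = serre x y - serre x z"
  by (simp add: serre_def algebra_simps)

lemma serre_scal: "serre x (scal c * y) = scal c * serre x y"
  by (simp add: serre_def algebra_simps scal_left scal_scal mult.commute)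

text \<open>Read modulo the Serre relations, with \<open>x\<close> and \<open>z\<close> commuting, this shows that \<open>y\<close> commutes
  with the iterated \<open>p\<close>-commutator \<open>w\<close> of \<open>x\<close>, \<open>y\<close>, \<open>z\<close>.\<close>
lemma serre_commute_identity:
  fixes x y z :: "'f::field falg"
  assumes p: "p = qq \<or> p = inverse qq"
  defines "w \<equiv> (x * y - scal p * (y * x)) * z - scal p * (z * (x * y - scal p * (y * x)))"
    and "k \<equiv> x * z - z * x"
  shows "scal (1 + p ^ 2) * (y * w - w * y) =
    scal p * ((y * k - k * y) * y) - scal (p ^ 3) * (y * (y * k - k * y))
    + scal p * (x * serre y z) - scal (p ^ 3) * (serre y z * x)
    - scal p * (serre y x * z) + scal (p ^ 3) * (z * serre y x)"
proof -
  have q: "qq * (inverse qq * c) = c" for c :: "'f ratfun"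
    by (simp flip: mult.assoc)
  then show ?thesis using p unfolding w_def k_def
    by (auto simp: serre_def algebra_simps scal_left scal_scal scal_add power2_eq_square power3_eq_cube q)
qed


locale uq_rank =
  fixes m n :: nat
  assumes mn: "1 \<le> m" "1 \<le> n"
begin

section \<open>The ideal of relations on the whole type\<close>

lemma uq_null_0 [simp]: "0 \<in> uq_null m n"
  by (simp add: uq_null_def uq_ideal_0[OF mn])

lemma uq_null_add: "x \<in> uq_null m n \<Longrightarrow> y \<in> uq_null m n \<Longrightarrow> x + y \<in> uq_null m n"
  by (simp add: uq_null_def uq_ideal_add[OF mn])

lemma uq_null_diff: "x \<in> uq_null m n \<Longrightarrow> y \<in> uq_null m n \<Longrightarrow> x - y \<in> uq_null m n"
  by (simp add: uq_null_def uq_ideal_diff[OF mn])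

lemma uq_null_uminus: "x \<in> uq_null m n \<Longrightarrow> - x \<in> uq_null m n"
  by (simp add: uq_null_def uq_ideal_uminus[OF mn])

lemma uq_null_lmult: "x \<in> uq_null m n \<Longrightarrow> y * x \<in> uq_null m n"
  by (simp add: uq_null_def uq_ideal_lmult[OF mn])

lemma uq_null_rmult: "x \<in> uq_null m n \<Longrightarrow> x * y \<in> uq_null m n"
  by (simp add: uq_null_def uq_ideal_rmult[OF mn])

lemmas uq_null_intros = uq_null_add uq_null_diff uq_null_lmult uq_null_rmult uq_null_uminus

lemma uq_null_ideal: "x \<in> uq_ideal m n \<Longrightarrow> x \<in> uq_null m n"
  by (simp add: uq_null_def ok_part_id uq_ideal_carrier[OF mn])

lemma uq_null_rels: "x \<in> uq_rels m n \<Longrightarrow> x \<in> uq_null m n"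
  by (rule uq_null_ideal[OF uq_rels_in_ideal])

lemma uq_null_Omega_free: "x \<in> uq_null m n \<Longrightarrow> Omega_free x \<in> uq_null m n"
  by (simp add: uq_null_def ok_part_Omega_free Omega_free_ideal[OF mn])

lemma uq_null_not_ok: "\<not> word_ok m n w \<Longrightarrow> mon w \<in> uq_null m n"
  by (simp add: uq_null_def mon_def ok_part_single uq_ideal_0[OF mn])

lemma uq_null_scal_cancel:
  assumes "c \<noteq> 0" "scal c * x \<in> uq_null m n"
  shows "x \<in> uq_null m n"
proof -
  have "scal (inverse c) * (scal c * x) \<in> uq_null m n"
    by (rule uq_null_lmult[OF assms(2)])
  then show ?thesis using assms(1) by (simp add: scal_scal)
qed

lemma uq_null_diff_cancel:
  "x - y \<in> uq_null m n \<Longrightarrow> y \<in> uq_null m n \<Longrightarrow> x \<in> uq_null m n"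
  using uq_null_add[of "x - y" y] by simp

lemma uq_null_cls_eq:
  assumes "x \<in> carrier (free_alg m n)" "y \<in> carrier (free_alg m n)" "cls m n x = cls m n y"
  shows "x - y \<in> uq_null m n"
  using assms by (intro uq_null_ideal) (simp add: cls_eq_iff[OF mn])

subsection \<open>Spans modulo the relations\<close>

text \<open>The linear span of \<open>A\<close> plus the ideal of relations, formed in the free
  algebra, so that rewriting modulo the relations is plain ring arithmetic.\<close>

inductive_set gspan :: "'f::field falg set \<Rightarrow> 'f falg set" for A where
  null: "x \<in> uq_null m n \<Longrightarrow> x \<in> gspan A"
| base: "x \<in> A \<Longrightarrow> x \<in> gspan A"
| add: "x \<in> gspan A \<Longrightarrow> y \<in> gspan A \<Longrightarrow> x + y \<in> gspan A"
| scale: "x \<in> gspan A \<Longrightarrow> scal c * x \<in> gspan A"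

lemma gspan_uminus: "x \<in> gspan A \<Longrightarrow> - x \<in> gspan A"
  using gspan.scale[of x A "- 1"] by (simp add: scal_uminus)

lemma gspan_diff: "x \<in> gspan A \<Longrightarrow> y \<in> gspan A \<Longrightarrow> x - y \<in> gspan A"
  using gspan.add[OF _ gspan_uminus, of x A y] by simp

lemma gspan_cong: "x - y \<in> uq_null m n \<Longrightarrow> y \<in> gspan A \<Longrightarrow> x \<in> gspan A"
  using gspan.add[OF gspan.null, of "x - y" y A] by simp

text \<open>The map taking \<open>x\<close> to \<open>u * x * v\<close> is linear and preserves the
  ideal, so only the spanning elements need checking.\<close>

lemma gspan_image:
  assumes "x \<in> gspan A" "\<And>a. a \<in> A \<Longrightarrow> u * a * v \<in> gspan B"
  shows "u * x * v \<in> gspan B"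
  using assms(1)
proof induction
  case (null x) then show ?case by (intro gspan.null uq_null_lmult uq_null_rmult)
next
  case (add x y) then show ?case using gspan.add[of "u * x * v" B "u * y * v"] by (simp add: algebra_simps)
next
  case (scale x c)
  have "u * (scal c * x) * v = scal c * (u * x * v)" by (simp add: scal_left mult.assoc)
  then show ?case using gspan.scale[OF scale.IH] by simp
qed (rule assms(2))

lemma gspan_trans: "x \<in> gspan A \<Longrightarrow> (\<And>a. a \<in> A \<Longrightarrow> a \<in> gspan B) \<Longrightarrow> x \<in> gspan B"
  using gspan_image[of x A 1 1 B] by simp

lemma gspan_lmult: "x \<in> gspan A \<Longrightarrow> (\<And>a. a \<in> A \<Longrightarrow> u * a \<in> gspan B) \<Longrightarrow> u * x \<in> gspan B"
  using gspan_image[of x A u 1 B] by simp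

lemma gspan_rmult: "x \<in> gspan A \<Longrightarrow> (\<And>a. a \<in> A \<Longrightarrow> a * v \<in> gspan B) \<Longrightarrow> x * v \<in> gspan B"
  using gspan_image[of x A 1 v B] by simp

text \<open>\<open>Omega_free\<close> is only semilinear, but it sends scalars to scalars and the
  ideal into itself, so it maps spans to spans.\<close>

lemma gspan_Omega_free:
  "x \<in> gspan A \<Longrightarrow> Omega_free x \<in> gspan (Omega_free ` A)"
proof (induction rule: gspan.induct)
  case (scale x c)
  then show ?case by (simp add: scal_commute[symmetric] gspan.scale)
qed (auto intro: gspan.intros uq_null_Omega_free)

subsection \<open>Commutation of root vectors with generators\<close>

lemma commute_null_mult:
  assumes "x * z - z * x \<in> uq_null m n" "y * z - z * y \<in> uq_null m n"
  shows "(x * y) * z - z * (x * y) \<in> uq_null m n"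
proof -
  have "x * (y * z - z * y) + (x * z - z * x) * y \<in> uq_null m n"
    by (intro uq_null_intros assms)
  then show ?thesis by (simp add: algebra_simps)
qed

lemma commute_null_twist:
  assumes "x * z - z * x \<in> uq_null m n" "y * z - z * y \<in> uq_null m n"
  shows "(x * y - scal c * (y * x)) * z - z * (x * y - scal c * (y * x)) \<in> uq_null m n"
proof -
  have "((x * y) * z - z * (x * y)) - scal c * ((y * x) * z - z * (y * x)) \<in> uq_null m n"
    by (intro uq_null_diff uq_null_lmult commute_null_mult assms)
  then show ?thesis by (simp add: algebra_simps scal_left)
qed

lemma commute_null_sym: "x * z - z * x \<in> uq_null m n \<Longrightarrow> z * x - x * z \<in> uq_null m n"
  using uq_null_uminus by fastforce

text \<open>Out-of-range generators are zero modulo \<open>uq_null\<close>; this extends the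
  commutation and Serre relations below to all indices.\<close>

lemma E_null:
  assumes "i < 1 \<or> m + n \<le> i" shows "(gE i :: 'f::field falg) \<in> uq_null m n"
proof -
  have "\<not> word_ok m n [GE i]" using assms by (auto simp: word_ok_def)
  from uq_null_not_ok[OF this] show ?thesis by (simp add: mon_def gen_def)
qed

lemma E_E_commute:
  assumes "i + 1 < j \<or> j + 1 < i"
  shows "gE i * gE j - gE j * gE i \<in> (uq_null m n :: 'f::field falg set)"
proof (cases "i \<in> {1..<m+n} \<and> j \<in> {1..<m+n}")
  case True
  then have "gE i * gE j - gE j * gE i \<in> (rels5 m n :: 'f falg set)"
    unfolding rels5_def using assms by (intro UnI1 CollectI exI[of _ i] exI[of _ j]) auto
  then show ?thesis by (intro uq_null_rels) (simp add: uq_rels_def)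
next
  case False
  then have "(gE i :: 'f falg) \<in> uq_null m n \<or> (gE j :: 'f falg) \<in> uq_null m n"
    using E_null[of i] E_null[of j] by auto
  then show ?thesis by (auto intro: uq_null_intros)
qed

lemma serre_null:
  assumes "i + 1 = j \<or> j + 1 = i" "i \<noteq> m"
  shows "serre (gE i) (gE j) \<in> (uq_null m n :: 'f::field falg set)"
proof (cases "i \<in> {1..<m+n} \<and> j \<in> {1..<m+n}")
  case True
  then have "serre (gE i) (gE j) \<in> (rels67 m n :: 'f falg set)"
    unfolding rels67_def using assms by (intro UnI1 CollectI exI[of _ i] exI[of _ j]) auto
  then show ?thesis by (intro uq_null_rels) (simp add: uq_rels_def)
next
  case False
  then have "(gE i :: 'f falg) \<in> uq_null m n \<or> (gE j :: 'f falg) \<in> uq_null m n"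
    using E_null[of i] E_null[of j] by auto
  then show ?thesis unfolding serre_def power2_eq_square by (auto intro!: uq_null_add uq_null_diff intro: uq_null_lmult uq_null_rmult)
qed

lemma rootE_Suc: "i < c \<Longrightarrow>
  rootE m i (Suc c) = rootE m i c * gE c - scal (inverse (qi m c)) * (gE c * rootE m i c)"
  by (simp add: rootE.simps)

lemma rootE_simple [simp]: "rootE m i (Suc i) = gE i"
  by (simp add: rootE.simps)

lemma rootE_split_null:
  assumes "1 \<le> i" "i < c" "c < j" "j \<le> m + n"
  shows "rootE m i j - (rootE m i c * rootE m c j - scal (inverse (qi m c)) * (rootE m c j * rootE m i c))
    \<in> (uq_null m n :: 'f::field falg set)"
  using assms by (intro uq_null_cls_eq rootE_split[OF mn]) auto

lemma rootE_E_commute_outside: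
  assumes "j < k \<or> k + 1 < i"
  shows "rootE m i j * gE k - gE k * rootE m i j \<in> (uq_null m n :: 'f::field falg set)"
  using assms
proof (induction j)
  case 0 then show ?case by (simp add: rootE.simps)
next
  case (Suc c)
  consider "c < i" | "c = i" | "i < c" by linarith
  then show ?case
  proof cases
    case 1 then show ?thesis by (simp add: rootE.simps)
  next
    case 2 then show ?thesis using Suc.prems E_E_commute[of i k] by simp
  next
    case 3
    then show ?thesis using Suc unfolding rootE_Suc[OF 3]
      by (intro commute_null_twist Suc.IH E_E_commute) auto
  qed
qed

lemma serre_null_twist:
  fixes x u y :: "'f::field falg"
  assumes u: "x * u - u * x \<in> uq_null m n" and s: "serre x y \<in> uq_null m n"
  shows "serre x (u * y - scal c * (y * u)) \<in> uq_null m n"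
    and "serre x (y * u - scal c * (u * y)) \<in> uq_null m n"
proof -
  have *: "serre x (u * y) \<in> uq_null m n" "serre x (y * u) \<in> uq_null m n"
    unfolding serre_mult_left[of x u y] serre_mult_right[of x y u]
    by (intro uq_null_add uq_null_diff uq_null_lmult[OF s] uq_null_rmult[OF s]
        uq_null_lmult[OF u] uq_null_lmult[OF uq_null_rmult[OF u]] uq_null_rmult[OF uq_null_add]
        uq_null_lmult[OF uq_null_add] uq_null_rmult[OF u] uq_null_lmult[OF uq_null_lmult[OF u]])+
  show "serre x (u * y - scal c * (y * u)) \<in> uq_null m n"
    "serre x (y * u - scal c * (u * y)) \<in> uq_null m n"
    by (simp_all add: serre_diff serre_scal uq_null_intros *)
qed

lemma serre_cong:
  assumes "y - z \<in> uq_null m n" "serre x z \<in> uq_null m n"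
  shows "serre x y \<in> uq_null m n"
proof -
  have "serre x (y - z) \<in> uq_null m n"
    unfolding serre_def by (intro uq_null_add uq_null_diff uq_null_lmult uq_null_rmult assms)
  then show ?thesis using assms(2) by (auto simp: serre_diff intro: uq_null_diff_cancel)
qed

text \<open>$E_{ki}$ is a twisted commutator of $E_{k,i-1}$, which commutes with $E_{i,i+1}$, and
  the neighbour $E_{i-1,i}$, for which the Serre relation is given.\<close>

lemma serre_rootE_right_end:
  assumes "k < i" "i \<noteq> m"
  shows "serre (gE i) (rootE m k i) \<in> (uq_null m n :: 'f::field falg set)"
proof -
  from assms obtain c where c: "i = Suc c" "k \<le> c" by (cases i) auto
  show ?thesis
  proof (cases "k = c")
    case True
    then show ?thesis using assms serre_null[of i c] c by simp
  next
    case False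
    then have k: "k < c" using c by simp
    show ?thesis unfolding c rootE_Suc[OF k]
      using assms c k by (intro serre_null_twist(1) serre_null commute_null_sym[OF rootE_E_commute_outside]) auto
  qed
qed

text \<open>Mirror image of the preceding argument. The recursion of \<open>rootE\<close> peels off
  the last letter, so the first one is split off by \<open>rootE_split_null\<close>.\<close>

lemma serre_rootE_left_end:
  assumes "i + 1 < j" "i \<noteq> m" "j \<le> m + n"
  shows "serre (gE i) (rootE m (i + 1) j) \<in> (uq_null m n :: 'f::field falg set)"
proof (cases "j = i + 2")
  case True
  then have "rootE m (i + 1) j = (gE (i + 1) :: 'f falg)" by simp
  then show ?thesis using serre_null[OF disjI1[OF refl] assms(2)] by (simp only:)
next
  case False
  then have "rootE m (i + 1) j - (gE (i + 1) * rootE m (i + 2) j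
      - scal (inverse (qi m (i + 2))) * (rootE m (i + 2) j * gE (i + 1))) \<in> (uq_null m n :: 'f falg set)"
    using assms rootE_split_null[of "i + 1" "i + 2" j] by simp
  then show ?thesis
    by (rule serre_cong)
      (use assms in \<open>intro serre_null_twist(2) serre_null commute_null_sym[OF rootE_E_commute_outside], auto\<close>)
qed

lemma iqi_cases: "inverse (qi m i) = qq \<or> inverse (qi m i) = inverse qq"
  by (simp add: qi_def)

lemma one_plus_q_square_nonzero:
  fixes p :: "'f::field ratfun"
  assumes "p = qq \<or> p = inverse qq" shows "1 + p ^ 2 \<noteq> 0"
proof -
  have "(1 + qq ^ 2 :: 'f ratfun) = Fract [:1, 0, 1:] 1"
    by (simp add: qq_def power2_eq_square One_fract_def one_pCons)
  also have "\<dots> \<noteq> 0" by (simp add: Zero_fract_def eq_fract)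
  finally have "(1 + qq ^ 2 :: 'f ratfun) \<noteq> 0" .
  moreover have "1 + inverse qq ^ 2 = inverse (qq ^ 2) * (1 + qq ^ 2 :: 'f ratfun)"
    by (simp add: field_simps)
  ultimately show ?thesis using assms by auto
qed

text \<open>Cut the interval at $i$ and $i + 1$: the outer pieces commute with each other and
  satisfy Serre relations with the middle letter, so \<open>serre_commute_identity\<close> applies
  and its factor $1 + p^2$ can be cancelled.\<close>

lemma rootE_E_commute_inside:
  assumes "1 \<le> k" "k < i" "i + 1 < j" "j \<le> m + n" "i \<noteq> m"
  shows "rootE m k j * gE i - gE i * rootE m k j \<in> (uq_null m n :: 'f::field falg set)"
proof -
  let ?p = "inverse (qi m i) :: 'f ratfun"
  \<comment> \<open>Both cuts carry the same twist because $i$ is not $m$; the identity has a single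
    parameter \<open>p\<close>.\<close>
  have p: "qi m (Suc i) = (qi m i :: 'f ratfun)" using \<open>i \<noteq> m\<close> by (simp add: qi_def)
  let ?x = "rootE m k i :: 'f falg" and ?y = "gE i :: 'f falg" and ?z = "rootE m (i + 1) j :: 'f falg"
  define w where "w = (?x * ?y - scal ?p * (?y * ?x)) * ?z - scal ?p * (?z * (?x * ?y - scal ?p * (?y * ?x)))"
  have xz: "?x * ?z - ?z * ?x \<in> uq_null m n"
    using assms(3)
  proof (induction j)
    case (Suc j)
    show ?case
    proof (cases "j = i + 1")
      case True
      then show ?thesis using rootE_E_commute_outside[of i "i+1" k] by simp
    next
      case False
      then have "i + 1 < j" using Suc.prems by simp
      then show ?thesis unfolding rootE_Suc[OF \<open>i + 1 < j\<close>] using assms Suc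
        by (intro commute_null_sym[OF commute_null_twist] commute_null_sym[OF Suc.IH] commute_null_sym[OF rootE_E_commute_outside]) auto
    qed
  qed simp
  have sx: "serre ?y ?x \<in> uq_null m n" using assms by (intro serre_rootE_right_end)
  have sz: "serre ?y ?z \<in> uq_null m n" using assms by (intro serre_rootE_left_end)
  have "scal (1 + ?p ^ 2) * (?y * w - w * ?y) \<in> uq_null m n"
    unfolding w_def serre_commute_identity[OF iqi_cases]
    by (intro uq_null_add uq_null_diff uq_null_lmult[of _ "scal _"]
        uq_null_lmult[OF sx] uq_null_lmult[OF sz] uq_null_rmult[OF sx] uq_null_rmult[OF sz]
        uq_null_lmult[of _ "gE i"] uq_null_rmult[of _ "gE i"] xz)
  then have yw: "?y * w - w * ?y \<in> uq_null m n"
    by (rule uq_null_scal_cancel[OF one_plus_q_square_nonzero[OF iqi_cases]])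
  have d: "rootE m k j - w \<in> uq_null m n"
    using rootE_split_null[of k "i + 1" j, where 'f = 'f] assms unfolding w_def
    by (simp add: rootE_Suc p)
  have "(rootE m k j - w) * ?y - ?y * (rootE m k j - w) - (?y * w - w * ?y) \<in> uq_null m n"
    by (rule uq_null_diff[OF uq_null_diff[OF uq_null_rmult[OF d] uq_null_lmult[OF d]] yw])
  then show ?thesis by (simp add: algebra_simps)
qed

subsection \<open>Quadratic relations between odd root vectors\<close>

text \<open>For fixed \<open>e\<close>, the assignment \<open>x \<mapsto> d\<close> is a derivation twisted by the character \<open>t\<close>; all the quadratic
  relations arise by applying these derivations to $E_{m,m+1}^2 = 0$ and to (R8).\<close>
definition der :: "'f::field falg \<Rightarrow> 'f ratfun \<Rightarrow> 'f falg \<Rightarrow> 'f falg \<Rightarrow> bool" where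
  "der e t x d \<longleftrightarrow> x * e - scal t * (e * x) - d \<in> uq_null m n"

lemma der_mult:
  assumes "der e t x d" "der e t' y d'"
  shows "der e (t * t') (x * y) (scal t' * (d * y) + x * d')"
proof -
  have "x * (y * e - scal t' * (e * y) - d') + scal t' * ((x * e - scal t * (e * x) - d) * y) \<in> uq_null m n"
    using assms unfolding der_def by (intro uq_null_add[OF uq_null_lmult uq_null_lmult[OF uq_null_rmult]])
  then show ?thesis
    by (simp add: der_def algebra_simps scal_left scal_scal)
qed

lemma der_add: "der e t x d \<Longrightarrow> der e t y d' \<Longrightarrow> der e t (x + y) (d + d')"
  unfolding der_def using uq_null_add by (fastforce simp: algebra_simps)

lemma der_scal:
  assumes "der e t x d" shows "der e t (scal c * x) (scal c * d)"
proof -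
  have "scal c * (x * e - scal t * (e * x) - d) \<in> uq_null m n"
    using assms unfolding der_def by (rule uq_null_lmult)
  then show ?thesis by (simp add: der_def algebra_simps scal_left scal_scal)
qed

lemma der_null:
  assumes "der e t x d" "x \<in> uq_null m n" shows "d \<in> uq_null m n"
proof -
  have "x * e - scal t * (e * x) - (x * e - scal t * (e * x) - d) \<in> uq_null m n"
    by (intro uq_null_diff[OF uq_null_diff[OF uq_null_rmult uq_null_lmult[OF uq_null_lmult]]]
        assms(1)[unfolded der_def] assms(2))
  then show ?thesis by (simp add: algebra_simps)
qed

text \<open>Both products \<open>x * y\<close> and \<open>y * x\<close> have twist
  \<open>t * t'\<close>, so the derivation can be applied to the whole relation, and it maps the
  ideal into itself.\<close>

lemma der_quadratic:
  assumes "der e t x d" "der e t' y d'" "x * y + scal c * (y * x) \<in> uq_null m n"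
  shows "scal t' * (d * y) + x * d' + scal c * (scal t * (d' * x) + y * d) \<in> uq_null m n"
proof -
  have "der e (t * t') (y * x) (scal t * (d' * x) + y * d)"
    using der_mult[OF assms(2,1)] by (simp add: mult.commute)
  from der_null[OF der_add[OF der_mult[OF assms(1,2)] der_scal[OF this]] assms(3)]
  show ?thesis .
qed

lemma der_commute: "x * e - e * x \<in> uq_null m n \<Longrightarrow> der e 1 x 0"
  by (simp add: der_def)

text \<open>The splitting of $E_{ab}$ at $c$, solved for $E_{cb} E_{ac}$: the row index moves from
  $c$ to $a$. In \<open>der_column\<close> the column index moves; there $q_c^{-1} = q$, so the
  twist is again $q$.\<close>

lemma der_row:
  assumes "1 \<le> a" "a < c" "c \<le> m" "c < b" "b \<le> m + n"
  shows "der (rootE m a c) qq (rootE m c b) (- scal qq * (rootE m a b :: 'f::field falg))"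
proof -
  have "scal qq * (rootE m a b - (rootE m a c * rootE m c b - scal (inverse (qi m c)) * (rootE m c b * rootE m a c)))
    \<in> (uq_null m n :: 'f falg set)"
    using assms by (intro uq_null_lmult rootE_split_null) auto
  then show ?thesis using assms
    by (simp add: der_def qi_def algebra_simps scal_left scal_scal)
qed

lemma der_column:
  assumes "1 \<le> a" "a < c" "m < c" "c < b" "b \<le> m + n"
  shows "der (rootE m c b) qq (rootE m a c) (rootE m a b :: 'f::field falg)"
proof -
  have "- (rootE m a b - (rootE m a c * rootE m c b - scal (inverse (qi m c)) * (rootE m c b * rootE m a c)))
    \<in> (uq_null m n :: 'f falg set)"
    using assms by (intro uq_null_uminus rootE_split_null) auto
  then show ?thesis using assms
    by (simp add: der_def qi_def algebra_simps scal_left scal_scal)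
qed

text \<open>$E_{ab}$ already is a twisted commutator with $E_{a,a+1}$. By the factorisation of the
  Serre polynomial the next one, with inverse twist, is zero.\<close>

lemma der_row_end:
  assumes "1 \<le> a" "a < m" "a + 1 < b" "b \<le> m + n"
  shows "der (gE a) (inverse qq) (rootE m a b) (0 :: 'f::field falg)"
proof -
  let ?x = "gE a :: 'f falg" and ?y = "rootE m (a + 1) b" and ?p = "inverse qq :: 'f ratfun"
  let ?w = "?x * ?y - scal ?p * (?y * ?x)"
  have d: "rootE m a b - ?w \<in> uq_null m n"
    using rootE_split_null[of a "a + 1" b] assms by (simp add: qi_def)
  have "serre ?x ?y \<in> uq_null m n" using assms by (intro serre_rootE_left_end) auto
  then have "?x * ?w - scal (inverse ?p) * (?w * ?x) \<in> uq_null m n"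
    by (subst serre_twist_left) auto
  then have "(rootE m a b - ?w) * ?x - scal ?p * (?x * (rootE m a b - ?w))
      - scal ?p * (?x * ?w - scal (inverse ?p) * (?w * ?x)) \<in> uq_null m n"
    by (rule uq_null_diff[OF uq_null_diff[OF uq_null_rmult[OF d] uq_null_lmult[OF uq_null_lmult[OF d]]] uq_null_lmult])
  moreover have "scal ?p * (scal (inverse ?p) * (?w * ?x)) = ?w * ?x"
    by (simp add: scal_scal)
  ultimately show ?thesis
    unfolding der_def by (simp only: right_diff_distrib left_diff_distrib) (simp add: algebra_simps)
qed

lemma der_column_end:
  assumes "1 \<le> a" "a < b" "m < b" "b + 1 \<le> m + n"
  shows "der (gE b) (inverse qq) (rootE m a (b + 1)) (0 :: 'f::field falg)"
proof -
  have eq: "(rootE m a (Suc b) :: 'f falg) = rootE m a b * gE b - scal qq * (gE b * rootE m a b)"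
    using assms by (simp add: rootE_Suc qi_def)
  have "serre (gE b) (rootE m a b) \<in> (uq_null m n :: 'f falg set)"
    using assms by (intro serre_rootE_right_end) auto
  then have "rootE m a (Suc b) * gE b - scal (inverse qq) * (gE b * rootE m a (Suc b))
      \<in> (uq_null m n :: 'f falg set)"
    unfolding eq by (subst serre_twist_right) auto
  then show ?thesis by (simp add: der_def)
qed

text \<open>\<open>rootE m c d\<close> is a polynomial in the letters \<open>gE i\<close> with $c
  \<le> i < d$. This serves both disjoint and nested intervals.\<close>

lemma rootE_rootE_commute_outside:
  assumes "\<And>i. c \<le> i \<Longrightarrow> i < d \<Longrightarrow> rootE m a b * gE i - gE i * rootE m a b \<in> (uq_null m n :: 'f::field falg set)"
  shows "rootE m a b * rootE m c d - rootE m c d * rootE m a b \<in> (uq_null m n :: 'f falg set)"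
  using assms
proof (induction d)
  case (Suc d)
  consider "d < c" | "d = c" | "c < d" by linarith
  then show ?case
  proof cases
    case 3
    then show ?thesis unfolding rootE_Suc[OF 3]
      by (intro commute_null_sym[OF commute_null_twist] commute_null_sym[OF Suc.IH] commute_null_sym[OF Suc.prems]) (auto intro: Suc.prems)
  qed (use Suc.prems in \<open>auto simp: rootE.simps\<close>)
qed (simp add: rootE.simps)

text \<open>Starting from (R4), first the column and then the row is moved one unit at a time. One
  derivation of $x^2 = 0$ gives $xy + q yx = 0$, a second one gives $y^2 = 0$ up to a nonzero
  factor.\<close>

lemma odd_root_square:
  assumes "1 \<le> a" "a \<le> m" "m < b" "b \<le> m + n"
  shows "rootE m a b * rootE m a b \<in> (uq_null m n :: 'f::field falg set)"
proof -
  have base: "rootE m m (Suc m) * rootE m m (Suc m) \<in> (uq_null m n :: 'f falg set)"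
    by (intro uq_null_rels) (simp add: uq_rels_def rels4_def power2_eq_square)
  have col: "rootE m m b * rootE m m b \<in> (uq_null m n :: 'f falg set)"
    using \<open>m < b\<close>[folded Suc_le_eq] \<open>b \<le> m + n\<close>
  proof (induction b rule: dec_induct)
    case (step b)
    let ?x = "rootE m m b :: 'f falg" and ?y = "rootE m m (b + 1) :: 'f falg"
    have dx: "der (gE b) qq ?x ?y" using der_column[of m b "b + 1"] step mn by simp
    have dy: "der (gE b) (inverse qq) ?y 0" using der_column_end[of m b] step mn by simp
    have "?x * ?y + scal qq * (?y * ?x) \<in> uq_null m n"
      using der_null[OF der_mult[OF dx dx]] step by (simp add: add.commute)
    from der_quadratic[OF dx dy this] have "scal (inverse qq + qq) * (?y * ?y) \<in> uq_null m n"
      by (simp add: scal_add distrib_right)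
    moreover have "inverse qq + qq = inverse qq * (1 + qq ^ 2 :: 'f ratfun)"
      by (simp add: field_simps power2_eq_square)
    ultimately have "scal (inverse qq * (1 + qq ^ 2)) * (?y * ?y) \<in> uq_null m n"
      by simp
    then have "?y * ?y \<in> uq_null m n"
      by (rule uq_null_scal_cancel[rotated]) (simp add: one_plus_q_square_nonzero)
    then show ?case by simp
  qed (rule base)
  show ?thesis using \<open>a \<le> m\<close> \<open>1 \<le> a\<close>
  proof (induction a rule: inc_induct)
    case (step a)
    let ?x = "rootE m (a + 1) b :: 'f falg" and ?y = "rootE m a b :: 'f falg"
    have dx: "der (gE a) qq ?x (- scal qq * ?y)" using der_row[of a "a + 1" b] step assms by simp
    have dy: "der (gE a) (inverse qq) ?y 0" using der_row_end[of a b] step assms by simp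
    \<comment> \<open>The derivation of $x^2$ is $-q (xy + q yx)$; the factor $-q^{-1}$ removes the
      unit.\<close>
    have "- (scal (inverse qq) * (- scal qq * ((scal qq * ?y) * ?x) - scal qq * (?x * ?y))) \<in> uq_null m n"
      using der_null[OF der_mult[OF dx dx]] step by (intro uq_null_uminus uq_null_lmult) (simp add: scal_left mult.assoc)
    then have "?x * ?y + scal qq * (?y * ?x) \<in> uq_null m n"
      by (simp add: algebra_simps scal_scal)
    from der_quadratic[OF dx dy this] have "- (scal (1 + qq ^ 2) * (?y * ?y)) \<in> uq_null m n"
      by (simp add: scal_add distrib_right scal_left mult.assoc scal_scal power2_eq_square)
    from uq_null_uminus[OF this] have "scal (1 + qq ^ 2) * (?y * ?y) \<in> uq_null m n" by simp
    then have "?y * ?y \<in> uq_null m n"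
      by (rule uq_null_scal_cancel[rotated]) (simp add: one_plus_q_square_nonzero)
    then show ?case by simp
  qed (rule col)
qed

lemma odd_root_same_row:
  assumes "1 \<le> a" "a \<le> m" "m < b" "b < d" "d \<le> m + n"
  shows "rootE m a b * rootE m a d + scal qq * (rootE m a d * rootE m a b) \<in> (uq_null m n :: 'f::field falg set)"
proof -
  have dx: "der (rootE m b d) qq (rootE m a b :: 'f falg) (rootE m a d)" using der_column[of a b d] assms by simp
  show ?thesis
    using der_null[OF der_mult[OF dx dx] odd_root_square] assms by (simp add: add.commute)
qed

lemma odd_root_same_column:
  assumes "1 \<le> a" "a < c" "c \<le> m" "m < b" "b \<le> m + n"
  shows "rootE m c b * rootE m a b + scal qq * (rootE m a b * rootE m c b) \<in> (uq_null m n :: 'f::field falg set)"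
proof -
  let ?x = "rootE m c b :: 'f falg" and ?y = "rootE m a b :: 'f falg"
  have dx: "der (rootE m a c) qq ?x (- scal qq * ?y)" using der_row[of a c b] assms by simp
  have "- (scal (inverse qq) * (- scal qq * ((scal qq * ?y) * ?x) - scal qq * (?x * ?y))) \<in> uq_null m n"
    using der_null[OF der_mult[OF dx dx] odd_root_square] assms
    by (intro uq_null_uminus uq_null_lmult) (simp add: scal_left mult.assoc)
  then show ?thesis by (simp add: algebra_simps scal_scal)
qed

text \<open>(R8) is the smallest nested pair. The outer root is enlarged first, while the inner one
  is still $E_{m,m+1}$ and commutes with the even vectors used; then the inner root is enlarged by
  even vectors lying strictly inside the outer one. Each derivation thus acts on one factor
  only.\<close>

lemma odd_root_nested:
  assumes "1 \<le> a" "a < c" "c \<le> m" "m < b" "b < d" "d \<le> m + n"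
  shows "rootE m a d * rootE m c b + rootE m c b * rootE m a d \<in> (uq_null m n :: 'f::field falg set)"
proof -
  let ?X = "\<lambda>i j. rootE m i j :: 'f falg"
  let ?P = "\<lambda>a c b d. ?X a d * ?X c b + scal 1 * (?X c b * ?X a d) \<in> uq_null m n"
  have 1: "?P (m - 1) m (m + 1) (m + 2)"
  proof -
    \<comment> \<open>The index bounds force $m, n \<ge> 2$, so (R8) is present; both entries are
      odd, so the bracket is an anticommutator.\<close>
    have "sbracket (root_parity m (m-1) (m+2)) (root_parity m m (m+1)) (?X (m-1) (m+2)) (gE m) \<in> rels8 m n"
      using assms by (simp add: rels8_def)
    then have "sbracket (root_parity m (m-1) (m+2)) (root_parity m m (m+1)) (?X (m-1) (m+2)) (gE m) \<in> uq_null m n"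
      by (intro uq_null_rels) (simp add: uq_rels_def)
    then show ?thesis by (simp add: sbracket_def root_parity_def)
  qed
  have 2: "?P a m (m + 1) (m + 2)"
  proof (cases "a = m - 1")
    case False
    then have "a < m - 1" using assms by simp
    have "der (?X a (m - 1)) qq (?X (m - 1) (m + 2)) (- scal qq * ?X a (m + 2))"
      using assms \<open>a < m - 1\<close> by (intro der_row) auto
    moreover have "der (?X a (m - 1)) 1 (?X m (m + 1)) 0"
      using assms by (intro der_commute rootE_rootE_commute_outside rootE_E_commute_outside) auto
    ultimately have "- scal qq * (?X a (m + 2) * ?X m (m + 1) + ?X m (m + 1) * ?X a (m + 2)) \<in> uq_null m n"
      using der_quadratic[OF _ _ 1] by (fastforce simp: algebra_simps scal_left)
    then show ?thesis using uq_null_scal_cancel[of "- qq"] by (simp add: scal_uminus)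
  qed (use 1 in simp)
  have 3: "?P a m (m + 1) d"
  proof (cases "d = m + 2")
    case False
    then have "m + 2 < d" using assms by simp
    have "der (?X (m + 2) d) qq (?X a (m + 2)) (?X a d)"
      using der_column[of a "m + 2" d] assms \<open>m + 2 < d\<close> by simp
    moreover have "der (?X (m + 2) d) 1 (?X m (m + 1)) 0"
      using assms by (intro der_commute rootE_rootE_commute_outside rootE_E_commute_outside) auto
    ultimately show ?thesis
      using der_quadratic[OF _ _ 2] by fastforce
  qed (use 2 in simp)
  have 4: "?P a m b d"
  proof (cases "b = m + 1")
    case False
    then have "m + 1 < b" using assms by simp
    have "der (?X (m + 1) b) qq (?X m (m + 1)) (?X m b)"
      using der_column[of m "m + 1" b] assms \<open>m + 1 < b\<close> by simp
    moreover have "der (?X (m + 1) b) 1 (?X a d) 0"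
      using assms by (intro der_commute rootE_rootE_commute_outside rootE_E_commute_inside) auto
    ultimately show ?thesis
      using der_quadratic[OF _ _ 3] by fastforce
  qed (use 3 in simp)
  show ?thesis
  proof (cases "c = m")
    case False
    then have "c < m" using assms by simp
    have "der (?X c m) qq (?X m b) (- scal qq * ?X c b)"
      using der_row[of c m b] assms \<open>c < m\<close> by simp
    moreover have "der (?X c m) 1 (?X a d) 0"
      using assms by (intro der_commute rootE_rootE_commute_outside rootE_E_commute_inside) auto
    ultimately have "- scal qq * (?X a d * ?X c b + ?X c b * ?X a d) \<in> uq_null m n"
      using der_quadratic[OF _ _ 4] by (fastforce simp: algebra_simps scal_left)
    then show ?thesis using uq_null_scal_cancel[of "- qq"] by (simp add: scal_uminus)
  qed (use 4 in simp)
qed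

text \<open>Commutation with $E_{ac}$ moves the row of either factor in the same-row relation for
  $E_{cb}$ and $E_{cd}$, which gives four terms.\<close>

lemma odd_root_crossing:
  assumes "1 \<le> a" "a < c" "c \<le> m" "m < b" "b < d" "d \<le> m + n"
  shows "rootE m c d * rootE m a b + rootE m a b * rootE m c d
    + scal (qq - inverse qq) * (rootE m a d * rootE m c b) \<in> (uq_null m n :: 'f::field falg set)"
proof -
  let ?X = "\<lambda>i j. rootE m i j :: 'f falg"
  have "der (?X a c) qq (?X c b) (- scal qq * ?X a b)" "der (?X a c) qq (?X c d) (- scal qq * ?X a d)"
    using der_row[of a c b] der_row[of a c d] assms by simp_all
  from der_quadratic[OF this odd_root_same_row] assms
  have "scal qq * (- scal qq * ?X a b * ?X c d) + ?X c b * (- scal qq * ?X a d) +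
    scal qq * (scal qq * (- scal qq * ?X a d * ?X c b) + ?X c d * (- scal qq * ?X a b)) \<in> uq_null m n"
    by simp
  \<comment> \<open>After scaling by $-q^{-2}$ the nested products carry $q$ and $q^{-1}$ in the two
    orders; subtracting $q^{-1}$ times the nested relation leaves $q - q^{-1}$.\<close>
  then have "- (scal (inverse qq) * (scal (inverse qq) * (scal qq * (- scal qq * ?X a b * ?X c d) + ?X c b * (- scal qq * ?X a d) +
    scal qq * (scal qq * (- scal qq * ?X a d * ?X c b) + ?X c d * (- scal qq * ?X a b)))))
    - scal (inverse qq) * (?X a d * ?X c b + ?X c b * ?X a d) \<in> uq_null m n"
    using odd_root_nested[of a c b d] assms by (intro uq_null_diff uq_null_uminus uq_null_lmult) auto
  then show ?thesis
    by (simp add: algebra_simps scal_left scal_scal scal_diff)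
qed

subsection \<open>Straightening\<close>

abbreviation odd_root_vec :: "nat \<times> nat \<Rightarrow> 'f::field falg" where
  "odd_root_vec p \<equiv> (case p of (i, j) \<Rightarrow> rootE m i j)"

definition odd_mon :: "(nat \<times> nat) list \<Rightarrow> 'f::field falg" where
  "odd_mon w = prod_list (map odd_root_vec w)"

abbreviation roots :: "(nat \<times> nat) set" where
  "roots \<equiv> set (odd_roots m n)"

abbreviation E1_set :: "'f::field falg set" where
  "E1_set \<equiv> {E1 m n d | d. \<forall>p \<in> roots. d p \<in> {0, 1}}"

lemma odd_mon_simps [simp]:
  "odd_mon [] = 1" "odd_mon (p # w) = odd_root_vec p * odd_mon w"
  "odd_mon (v @ w) = odd_mon v * odd_mon w"
  by (simp_all add: odd_mon_def)

lemma roots_iff: "(a, b) \<in> roots \<longleftrightarrow> 1 \<le> a \<and> a \<le> m \<and> m < b \<and> b \<le> m + n"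
  by (auto simp: odd_roots_def)

lemma sorted_odd_roots: "sorted_wrt (<) (odd_roots m n)"
proof -
  have "sorted_wrt (<) (List.product xs ys)" if "sorted_wrt (<) xs" "sorted_wrt (<) ys"
    for xs ys :: "nat list"
    using that by (induction xs) (auto simp: sorted_wrt_append sorted_wrt_map)
  then show ?thesis by (simp add: odd_roots_def del: upt_Suc)
qed

text \<open>The recorded condition \<open>r < p\<close> is what termination rests on: the first
  letter drops, so the word drops lexicographically whatever follows.\<close>

lemma odd_root_straighten:
  assumes p: "p \<in> roots" and q: "q \<in> roots" and "q \<le> p"
  shows "odd_root_vec p * odd_root_vec q \<in>
    gspan {odd_root_vec r * odd_root_vec s :: 'f::field falg | r s. r \<in> roots \<and> s \<in> roots \<and> r < p}"
    (is "_ \<in> gspan ?B")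
proof -
  obtain c d a b where pq: "p = (c, d)" "q = (a, b)" by fastforce
  let ?X = "\<lambda>i j. rootE m i j :: 'f falg"
  have bounds: "1 \<le> a" "a \<le> m" "m < b" "b \<le> m + n" "1 \<le> c" "c \<le> m" "m < d" "d \<le> m + n"
    using p q by (simp_all add: pq roots_iff)
  have qp: "?X a b * ?X c d \<in> gspan ?B" if "q < p"
    using that p q by (intro gspan.base CollectI exI[of _ q] exI[of _ p]) (auto simp: pq)
  consider "a = c" "b = d" | "a = c" "b < d" | "a < c" "b = d" | "a < c" "b < d" | "a < c" "d < b"
    using \<open>q \<le> p\<close> by (fastforce simp: pq)
  then have "?X c d * ?X a b \<in> gspan ?B"
  proof cases
    case 1 then show ?thesis using odd_root_square bounds by (intro gspan.null) auto
  next
    case 2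
    have "scal (inverse qq) * (?X a b * ?X c d + scal qq * (?X c d * ?X a b)) \<in> uq_null m n"
      using 2 bounds odd_root_same_row[of a b d] by (intro uq_null_lmult) auto
    then have "?X c d * ?X a b - scal (- inverse qq) * (?X a b * ?X c d) \<in> uq_null m n"
      by (simp add: algebra_simps scal_scal scal_uminus)
    then show ?thesis by (rule gspan_cong[OF _ gspan.scale[OF qp]]) (use 2 in \<open>simp add: pq\<close>)
  next
    case 3
    then have "?X c d * ?X a b - scal (- qq) * (?X a b * ?X c d) \<in> uq_null m n"
      using bounds odd_root_same_column[of a c b] by (simp add: scal_uminus)
    then show ?thesis by (rule gspan_cong[OF _ gspan.scale[OF qp]]) (use 3 in \<open>simp add: pq\<close>)
  next
    case 4
    have ad: "?X a d * ?X c b \<in> gspan ?B"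
      using 4 bounds by (intro gspan.base CollectI exI[of _ "(a, d)"] exI[of _ "(c, b)"]) (auto simp: pq roots_iff)
    have "?X c d * ?X a b - (- (?X a b * ?X c d) - scal (qq - inverse qq) * (?X a d * ?X c b)) \<in> uq_null m n"
      using 4 bounds odd_root_crossing[of a c b d] by (simp add: algebra_simps)
    then show ?thesis
      by (rule gspan_cong) (use 4 in \<open>intro gspan_diff gspan_uminus gspan.scale qp ad, auto simp: pq\<close>)
  next
    case 5
    have "?X c d * ?X a b - (- (?X a b * ?X c d)) \<in> uq_null m n"
      using 5 bounds odd_root_nested[of a c d b] by (simp add: add.commute)
    then show ?thesis by (rule gspan_cong[OF _ gspan_uminus[OF qp]]) (use 5 in \<open>simp add: pq\<close>)
  qed
  then show ?thesis by (simp add: pq)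
qed

lemma not_strict_sortedE:
  assumes "\<not> sorted_wrt (<) (w :: 'a::linorder list)"
  obtains u p q v where "w = u @ p # q # v" "q \<le> p"
proof -
  have "\<exists>u p q v. w = u @ p # q # v \<and> q \<le> p"
    using assms
  proof (induction w)
    case (Cons x w)
    show ?case
    proof (cases "sorted_wrt (<) w")
      case False
      with Cons.IH show ?thesis by (metis append_Cons)
    next
      case True
      then obtain q v where "w = q # v" using Cons.prems by (cases w) auto
      moreover from this True Cons.prems have "q \<le> x" by fastforce
      ultimately show ?thesis by (metis append_Nil)
    qed
  qed simp
  then show thesis using that by blast
qed

text \<open>Deleting a root means exponent 0. A strictly increasing word is the sublist of
  \<open>odd_roots m n\<close> formed by its own letters, hence an \<open>E1\<close> with indicator
  exponents.\<close>

lemma odd_mon_filter: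
  "odd_mon (filter P w) = prod_list (map (\<lambda>(i, j). rootE m i j ^ of_bool (P (i, j))) w)"
  by (induction w) auto

text \<open>Straightening an adjacent pair lowers the word lexicographically and keeps its length.\<close>
lemma odd_mon_gspan:
  assumes "set w \<subseteq> roots"
  shows "odd_mon w \<in> gspan (E1_set :: 'f::field falg set)"
proof -
  let ?r = "{(x, y). x < y} :: ((nat \<times> nat) \<times> (nat \<times> nat)) set"
  have "wf (lenlex ?r)" by (intro wf_lenlex wf)
  then show ?thesis using assms
  proof (induction w rule: wf_induct_rule)
    case (less w)
    show ?case
    proof (cases "sorted_wrt (<) w")
      case True
      have "w = filter (\<lambda>p. p \<in> set w) (odd_roots m n)"
        using True sorted_odd_roots less.prems
        by (intro sorted_distinct_set_unique) (auto simp: strict_sorted_iff sorted_wrt_filter)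
      then have "odd_mon w = odd_mon (filter (\<lambda>p. p \<in> set w) (odd_roots m n))" by simp
      also have "\<dots> = E1 m n (\<lambda>p. of_bool (p \<in> set w))"
        unfolding odd_mon_filter E1_def ..
      finally show ?thesis
        by (intro gspan.base CollectI exI[of _ "\<lambda>p. of_bool (p \<in> set w)"]) simp
    next
      case False
      then obtain u p q v where w: "w = u @ p # q # v" and "q \<le> p" by (rule not_strict_sortedE)
      have "odd_mon u * (odd_root_vec p * odd_root_vec q) * odd_mon v \<in> gspan (E1_set :: 'f falg set)"
      proof (rule gspan_image[OF odd_root_straighten])
        fix x :: "'f falg"
        assume "x \<in> {odd_root_vec r * odd_root_vec s | r s. r \<in> roots \<and> s \<in> roots \<and> r < p}"
        then obtain r s where x: "x = odd_root_vec r * odd_root_vec s"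
          and rs: "r \<in> roots" "s \<in> roots" "r < p" by blast
        have "(u @ r # s # v, w) \<in> lenlex ?r"
          unfolding w lenlex_conv using rs by (auto intro!: lex_append_leftI)
        then have "odd_mon (u @ r # s # v) \<in> gspan (E1_set :: 'f falg set)"
          using less.prems rs by (intro less.IH) (auto simp: w)
        then show "odd_mon u * x * odd_mon v \<in> gspan E1_set" by (simp add: x mult.assoc)
      qed (use less.prems \<open>q \<le> p\<close> in \<open>auto simp: w\<close>)
      then show ?thesis by (simp add: w mult.assoc)
    qed
  qed
qed

subsection \<open>The positive and the negative part\<close>

definition even_gens :: "uq_gen set" where
  "even_gens = {g. gen_ok m n g} - {GE m, GF m}"

lemma gen_mon: "gen g = mon [g]"
  by (simp add: mon_def gen_def)

text \<open>The cases compare $i$ with the ends of the root: just outside an end, $E_{i,i+1}$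
  lengthens the root by one; at an end on the inside, the commutator with twist $q^{-1}$ vanishes;
  otherwise the two commute.\<close>

lemma odd_root_E:
  assumes "p \<in> roots" "1 \<le> i" "i < m + n" "i \<noteq> m"
  obtains t d where "der (gE i) t (odd_root_vec p :: 'f::field falg) d"
    "d \<in> gspan (odd_root_vec ` roots)"
proof -
  obtain a b where p: "p = (a, b)" by force
  with assms have bounds: "1 \<le> a" "a \<le> m" "m < b" "b \<le> m + n" by (simp_all add: roots_iff)
  let ?X = "\<lambda>i j. rootE m i j :: 'f falg" and ?B = "odd_root_vec ` roots :: 'f falg set"
  have X: "?X k l \<in> gspan ?B" if "(k, l) \<in> roots" for k l
    using that by (intro gspan.base image_eqI[of _ _ "(k, l)"]) auto
  have 0: "0 \<in> gspan ?B" by (intro gspan.null) simp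
  consider "b < i \<or> i + 1 < a" | "i + 1 = a" | "i = a" | "a < i" "i + 1 < b" | "i + 1 = b" "m < i" | "i = b"
    using bounds \<open>i \<noteq> m\<close> by linarith
  then have "\<exists>t d. der (gE i) t (?X a b) d \<and> d \<in> gspan ?B"
  proof cases
    case 1
    then show ?thesis using der_commute[OF rootE_E_commute_outside] 0 by blast
  next
    case 2
    then have "der (gE i) qq (?X a b) (- scal qq * ?X i b)" using der_row[of i a b] assms bounds by auto
    moreover have "- scal qq * ?X i b \<in> gspan ?B"
      using 2 assms bounds X[of i b] gspan.scale[of _ ?B "- qq"] by (simp add: roots_iff scal_uminus)
    ultimately show ?thesis by blast
  next
    case 3
    then show ?thesis using der_row_end[of a b] 0 bounds assms by fastforce
  next
    case 4
    then show ?thesis using der_commute[OF rootE_E_commute_inside[of a i b]] 0 bounds assms by blast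
  next
    case 5
    then show ?thesis using der_column_end[of a i] 0 bounds assms by fastforce
  next
    case 6
    then have "der (gE i) qq (?X a b) (?X a (b + 1))" using der_column[of a b "b + 1"] assms bounds by simp
    then show ?thesis using X[of a "b + 1"] 6 assms bounds by (auto simp: roots_iff)
  qed
  then show thesis using that by (auto simp: p)
qed

text \<open>Passing the even letter leftwards across one odd letter leaves either that letter
  unchanged or a combination of odd letters without the even one.\<close>

lemma odd_mon_E:
  assumes "set w \<subseteq> roots" "1 \<le> i" "i < m + n" "i \<noteq> m"
  shows "odd_mon w * gE i \<in>
    gspan {mon u * odd_mon v :: 'f::field falg | u v. set u \<subseteq> even_gens \<and> set v \<subseteq> roots}"
    (is "_ \<in> gspan ?B")
  using assms(1)
proof (induction w rule: rev_induct)
  case Nil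
  have "GE i \<in> even_gens" using assms by (simp add: even_gens_def)
  then show ?case by (intro gspan.base CollectI exI[of _ "[GE i]"] exI[of _ "[]"]) (simp add: gen_mon)
next
  case (snoc p w)
  then obtain t d where d: "der (gE i) t (odd_root_vec p :: 'f falg) d" "d \<in> gspan (odd_root_vec ` roots)"
    using odd_root_E[of p i] assms by auto
  have "odd_mon w * (odd_root_vec p * gE i - scal t * (gE i * odd_root_vec p) - d) \<in> (uq_null m n :: 'f falg set)"
    using d(1) unfolding der_def by (rule uq_null_lmult)
  then have "odd_mon (w @ [p]) * gE i - (scal t * (odd_mon w * gE i * odd_root_vec p) + odd_mon w * d)
      \<in> (uq_null m n :: 'f falg set)"
    by (simp add: algebra_simps scal_left)
  moreover have "odd_mon w * gE i * odd_root_vec p \<in> gspan ?B"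
  proof (rule gspan_rmult[OF snoc.IH])
    fix x :: "'f falg" assume "x \<in> ?B"
    then obtain u v where "x = mon u * odd_mon v" "set u \<subseteq> even_gens" "set v \<subseteq> roots" by blast
    then show "x * odd_root_vec p \<in> gspan ?B" using snoc.prems
      by (intro gspan.base CollectI exI[of _ u] exI[of _ "v @ [p]"]) (auto simp: mult.assoc)
  qed (use snoc.prems in simp)
  moreover have "odd_mon w * d \<in> gspan ?B"
  proof (rule gspan_lmult[OF d(2)])
    fix x :: "'f falg" assume "x \<in> odd_root_vec ` roots"
    then obtain r where "r \<in> roots" "x = odd_root_vec r" by blast
    then show "odd_mon w * x \<in> gspan ?B" using snoc.prems
      by (intro gspan.base CollectI exI[of _ "[]"] exI[of _ "w @ [r]"]) auto
  qed
  ultimately show ?case by (rule gspan_cong[OF _ gspan.add[OF gspan.scale]])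
qed

lemma E_word_gspan:
  assumes "set w \<subseteq> GE ` {1..<m+n}"
  shows "mon w \<in> gspan {mon u * e :: 'f::field falg | u e. set u \<subseteq> even_gens \<and> e \<in> E1_set}"
proof -
  let ?B = "{mon u * odd_mon v :: 'f falg | u v. set u \<subseteq> even_gens \<and> set v \<subseteq> roots}"
  have "mon w \<in> gspan ?B" using assms
  proof (induction w rule: rev_induct)
    case Nil
    show ?case by (intro gspan.base CollectI exI[of _ "[]"]) simp
  next
    case (snoc g w)
    then obtain i where g: "g = GE i" and i: "1 \<le> i" "i < m + n" by auto
    have "mon w * gE i \<in> gspan ?B"
    proof (rule gspan_rmult[OF snoc.IH])
      fix x assume "x \<in> ?B"
      then obtain u v where x: "x = mon u * odd_mon v" and uv: "set u \<subseteq> even_gens" "set v \<subseteq> roots" by blast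
      show "x * gE i \<in> gspan ?B"
      proof (cases "i = m")
        \<comment> \<open>$E_{m,m+1}$ is itself the odd root vector of $(m, m+1)$ and just lengthens
          the odd word.\<close>
        case True
        then show ?thesis using uv mn
          by (intro gspan.base CollectI exI[of _ u] exI[of _ "v @ [(m, Suc m)]"]) (auto simp: x mult.assoc roots_iff)
      next
        case False
        have "mon u * (odd_mon v * gE i) \<in> gspan ?B"
        proof (rule gspan_lmult[OF odd_mon_E[OF uv(2) i False]])
          fix y assume "y \<in> ?B"
          then obtain u' v' where "y = mon u' * odd_mon v'" "set u' \<subseteq> even_gens" "set v' \<subseteq> roots" by blast
          then show "mon u * y \<in> gspan ?B" using uv
            by (intro gspan.base CollectI exI[of _ "u @ u'"] exI[of _ v']) (auto simp: mult.assoc)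
        qed
        then show ?thesis by (simp add: x mult.assoc)
      qed
    qed (use snoc.prems in auto)
    then show ?case by (simp add: g gen_mon)
  qed
  then show ?thesis
  proof (rule gspan_trans)
    fix x assume "x \<in> ?B"
    then obtain u v where x: "x = mon u * odd_mon v" and uv: "set u \<subseteq> even_gens" "set v \<subseteq> roots" by blast
    show "x \<in> gspan {mon u * e | u e. set u \<subseteq> even_gens \<and> e \<in> E1_set}"
      unfolding x by (rule gspan_lmult[OF odd_mon_gspan[OF uv(2)]]) (use uv in \<open>blast intro: gspan.base\<close>)
  qed
qed

lemma even_gens_rev_swap: "set u \<subseteq> even_gens \<Longrightarrow> set (rev (map swap_gen u)) \<subseteq> even_gens"
proof -
  have "swap_gen g \<in> even_gens" if "g \<in> even_gens" for g
    using that by (cases g) (auto simp: even_gens_def)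
  then show "set u \<subseteq> even_gens \<Longrightarrow> set (rev (map swap_gen u)) \<subseteq> even_gens" by auto
qed

text \<open>An anti-automorphism reverses the order, so the odd factor, on the right for E-words,
  comes out on the left.\<close>

lemma F_word_gspan:
  assumes "set w \<subseteq> GF ` {1..<m+n}"
  shows "mon w \<in> gspan {Omega_free e * mon u :: 'f::field falg | u e. set u \<subseteq> even_gens \<and> e \<in> E1_set}"
proof -
  let ?w = "rev (map swap_gen w)"
  have "set ?w \<subseteq> GE ` {1..<m+n}" using assms by auto
  from gspan_Omega_free[OF E_word_gspan[OF this]]
  have "mon w \<in> gspan (Omega_free ` {mon u * e :: 'f falg | u e. set u \<subseteq> even_gens \<and> e \<in> E1_set})"
    unfolding Omega_free_mon rev_swap_rev_swap .
  then show ?thesis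
  proof (rule gspan_trans)
    fix x :: "'f falg" assume "x \<in> Omega_free ` {mon u * e | u e. set u \<subseteq> even_gens \<and> e \<in> E1_set}"
    then obtain u e where "x = Omega_free (mon u * e)" "set u \<subseteq> even_gens" "e \<in> E1_set" by blast
    then show "x \<in> gspan {Omega_free e * mon u | u e. set u \<subseteq> even_gens \<and> e \<in> E1_set}"
      using even_gens_rev_swap[of u]
      by (intro gspan.base CollectI exI[of _ "rev (map swap_gen u)"] exI[of _ e]) (simp add: Omega_free_mon del: rev_map)
  qed
qed

subsection \<open>Triangular decomposition\<close>

abbreviation E_gens :: "uq_gen set" where "E_gens \<equiv> GE ` {1..<m+n}"
abbreviation F_gens :: "uq_gen set" where "F_gens \<equiv> GF ` {1..<m+n}"
abbreviation K_gens :: "uq_gen set" where "K_gens \<equiv> GK ` {1..m+n} \<union> GKinv ` {1..m+n}"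

lemma gen_ok_cases: "gen_ok m n g \<longleftrightarrow> g \<in> E_gens \<union> F_gens \<union> K_gens"
  by (cases g) auto

text \<open>Spans do not see the power of $q$, so only its being nonzero is kept; this makes the
  relation symmetric.\<close>

definition qcommute :: "'f::field falg \<Rightarrow> 'f falg \<Rightarrow> bool" where
  "qcommute x y \<longleftrightarrow> (\<exists>c. c \<noteq> 0 \<and> x * y - scal c * (y * x) \<in> uq_null m n)"

lemma qcommute_sym:
  assumes "qcommute x y" shows "qcommute y x"
proof -
  from assms obtain c where c: "c \<noteq> 0" "x * y - scal c * (y * x) \<in> uq_null m n"
    by (auto simp: qcommute_def)
  have "- (scal (inverse c) * (x * y - scal c * (y * x))) \<in> uq_null m n"
    by (intro uq_null_uminus uq_null_lmult c(2))
  then show ?thesis using c(1) unfolding qcommute_def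
    by (intro exI[of _ "inverse c"]) (simp add: algebra_simps scal_scal)
qed

lemma qcommute_mult:
  assumes "qcommute x z" "qcommute y z" shows "qcommute (x * y) z"
proof -
  obtain c d where cd: "c \<noteq> 0" "d \<noteq> 0" "x * z - scal c * (z * x) \<in> uq_null m n"
      "y * z - scal d * (z * y) \<in> uq_null m n"
    using assms by (auto simp: qcommute_def)
  have "x * (y * z - scal d * (z * y)) + scal d * ((x * z - scal c * (z * x)) * y) \<in> uq_null m n"
    by (rule uq_null_add[OF uq_null_lmult[OF cd(4)] uq_null_lmult[OF uq_null_rmult[OF cd(3)]]])
  then show ?thesis using cd(1,2) unfolding qcommute_def
    by (intro exI[of _ "d * c"]) (simp add: algebra_simps scal_left scal_scal)
qed

lemma qcommute_mon: "(\<And>g. g \<in> set w \<Longrightarrow> qcommute (gen g) z) \<Longrightarrow> qcommute (mon w) z"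
proof (induction w)
  case Nil
  show ?case unfolding qcommute_def by (intro exI[of _ 1]) simp
qed (simp add: mon_Cons qcommute_mult)

lemma qcommute_mon_mon:
  assumes "\<And>g h. g \<in> set v \<Longrightarrow> h \<in> set w \<Longrightarrow> qcommute (gen g) (gen h :: 'f::field falg)"
  shows "qcommute (mon v) (mon w :: 'f falg)"
proof (rule qcommute_mon)
  fix g assume "g \<in> set v"
  then have "qcommute (mon w) (gen g :: 'f falg)"
    by (intro qcommute_mon) (rule qcommute_sym[OF assms])
  then show "qcommute (gen g) (mon w :: 'f falg)" by (rule qcommute_sym)
qed

lemma qcommute_gspan:
  assumes "qcommute x y" "u * (y * x) * v \<in> gspan A" shows "u * (x * y) * v \<in> gspan A"
proof -
  from assms(1) obtain c where "x * y - scal c * (y * x) \<in> uq_null m n"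
    by (auto simp: qcommute_def)
  then have "u * (x * y - scal c * (y * x)) * v \<in> uq_null m n"
    by (rule uq_null_rmult[OF uq_null_lmult])
  then have "u * (x * y) * v - scal c * (u * (y * x) * v) \<in> uq_null m n"
    by (simp add: algebra_simps scal_left)
  then show ?thesis by (rule gspan_cong[OF _ gspan.scale[OF assms(2)]])
qed

lemma K_Kinv_null:
  assumes "i \<in> {1..m+n}"
  shows "gK i * gKinv i - 1 \<in> uq_null m n" "gKinv i * gK i - 1 \<in> uq_null m n"
  using K_Kinv_ideal[OF mn assms] by (auto intro: uq_null_ideal)

text \<open>With \<open>b\<close> inverse to \<open>a\<close>, multiplying the conjugation relation
  by \<open>a\<close> on the right, or by \<open>b\<close> on the left, gives commutation with
  \<open>a\<close>, respectively \<open>b\<close>.\<close>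

lemma qcommute_conjugate:
  assumes ab: "b * a - 1 \<in> uq_null m n" and x: "a * x * b - scal c * x \<in> uq_null m n" and "c \<noteq> 0"
  shows "qcommute x a" "qcommute x b"
proof -
  have "(a * x * b - scal c * x) * a - a * x * (b * a - 1) \<in> uq_null m n"
    by (intro uq_null_diff uq_null_rmult[OF x] uq_null_lmult[OF ab])
  then have "a * x - scal c * (x * a) \<in> uq_null m n" by (simp add: algebra_simps)
  then show "qcommute x a" using \<open>c \<noteq> 0\<close> by (intro qcommute_sym[of a]) (auto simp: qcommute_def)
  have "b * (a * x * b - scal c * x) - (b * a - 1) * (x * b) \<in> uq_null m n"
    by (intro uq_null_diff uq_null_lmult[OF x] uq_null_rmult[OF ab])
  then have "x * b - scal c * (b * x) \<in> uq_null m n" by (simp add: algebra_simps scal_left)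
  then show "qcommute x b" using \<open>c \<noteq> 0\<close> by (auto simp: qcommute_def)
qed

lemma qcommute_K:
  assumes "g \<in> E_gens \<union> F_gens" "k \<in> K_gens"
  shows "qcommute (gen g) (gen k :: 'f::field falg)"
proof -
  from assms(2) obtain i where i: "i \<in> {1..m+n}" and k: "k = GK i \<or> k = GKinv i" by blast
  have "\<exists>c. c \<noteq> 0 \<and> gK i * gen g * gKinv i - scal c * gen g \<in> (uq_null m n :: 'f falg set)"
  proof -
    consider j where "g = GE j" "j \<in> {1..<m+n}" | j where "g = GF j" "j \<in> {1..<m+n}"
      using assms(1) by blast
    then show ?thesis
    proof cases
      case 1
      have "gK i * gE j * gKinv i - scal (qi m i powi wt i j) * gE j \<in> (rels2 m n :: 'f falg set)"
        unfolding rels2_def using i 1(2) by blast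
      then have "gK i * gE j * gKinv i - scal (qi m i powi wt i j) * gE j \<in> (uq_null m n :: 'f falg set)"
        by (intro uq_null_rels) (simp add: uq_rels_def)
      then show ?thesis by (intro exI[of _ "qi m i powi wt i j"]) (simp add: 1 qi_def)
    next
      case 2
      have "gK i * gF j * gKinv i - scal (qi m i powi (- wt i j)) * gF j \<in> (rels2 m n :: 'f falg set)"
        unfolding rels2_def using i 2(2) by blast
      then have "gK i * gF j * gKinv i - scal (qi m i powi (- wt i j)) * gF j \<in> (uq_null m n :: 'f falg set)"
        by (intro uq_null_rels) (simp add: uq_rels_def)
      then show ?thesis by (intro exI[of _ "qi m i powi (- wt i j)"]) (simp add: 2 qi_def)
    qed
  qed
  then obtain c where "c \<noteq> 0" "gK i * gen g * gKinv i - scal c * gen g \<in> (uq_null m n :: 'f falg set)"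
    by blast
  from qcommute_conjugate[OF K_Kinv_null(2)[OF i] this(2,1)] k show ?thesis by auto
qed

lemma E_F_swap:
  assumes "i \<in> {1..<m+n}" "j \<in> {1..<m+n}"
  obtains c D where "gE i * gF j - scal c * (gF j * gE i) - D \<in> (uq_null m n :: 'f::field falg set)"
    "D \<in> gspan {mon k | k. set k \<subseteq> K_gens}"
proof -
  let ?s = "root_parity m i (i+1) * root_parity m j (j+1)"
  let ?K = "mon [GK i, GKinv (i+1)] - mon [GKinv i, GK (i+1)] :: 'f falg"
  define D where "D = (if i = j then scal (inverse (qi m i - inverse (qi m i))) * ?K else 0)"
  have "(if i = j then scal (inverse (qi m i - inverse (qi m i)))
      * (gK i * gKinv (i+1) - gKinv i * gK (i+1)) else 0) = D"
    by (simp add: D_def mon_Cons)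
  moreover have "sbracket (root_parity m i (i+1)) (root_parity m j (j+1)) (gE i) (gF j)
      - (if i = j then scal (inverse (qi m i - inverse (qi m i)))
        * (gK i * gKinv (i+1) - gKinv i * gK (i+1)) else 0) \<in> (rels3 m n :: 'f falg set)"
    unfolding rels3_def using assms by blast
  ultimately have "sbracket (root_parity m i (i+1)) (root_parity m j (j+1)) (gE i) (gF j) - D \<in> uq_null m n"
    by (intro uq_null_rels) (simp add: uq_rels_def)
  \<comment> \<open>The sign of the supercommutator becomes a scalar.\<close>
  moreover have "(-1) ^ ?s = (scal ((-1) ^ ?s) :: 'f falg)"
    by (cases "even ?s") (simp_all add: scal_uminus)
  ultimately have "gE i * gF j - scal ((-1) ^ ?s) * (gF j * gE i) - D \<in> uq_null m n"
    by (simp add: sbracket_def)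
  moreover have "D \<in> gspan {mon k | k. set k \<subseteq> K_gens}"
  proof (cases "i = j")
    case True
    have "mon k \<in> gspan {mon k :: 'f falg | k. set k \<subseteq> K_gens}" if "set k \<subseteq> K_gens" for k
      using that by (blast intro: gspan.base)
    then have "?K \<in> gspan {mon k | k. set k \<subseteq> K_gens}"
      using assms by (intro gspan_diff) auto
    then show ?thesis using True by (auto simp: D_def intro: gspan.scale gspan_diff)
  qed (auto simp: D_def intro: gspan.null)
  ultimately show thesis by (rule that)
qed

text \<open>Moving left, the F-letter either reaches the front or is absorbed by one E-letter,
  leaving a combination of K-words that move to the front.\<close>

lemma E_word_F:
  assumes "set e \<subseteq> E_gens" "j \<in> {1..<m+n}"
  shows "mon e * gF j \<in> gspan ({gF j * mon e' | e'. set e' \<subseteq> E_gens}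
    \<union> {mon k * mon e' :: 'f::field falg | k e'. set k \<subseteq> K_gens \<and> set e' \<subseteq> E_gens})"
    (is "_ \<in> gspan ?B")
  using assms(1)
proof (induction e rule: rev_induct)
  case Nil
  show ?case by (intro gspan.base UnI1 CollectI exI[of _ "[]"]) simp
next
  case (snoc g e)
  then obtain i where g: "g = GE i" and i: "i \<in> {1..<m+n}" by auto
  obtain c D where D: "gE i * gF j - scal c * (gF j * gE i) - D \<in> (uq_null m n :: 'f falg set)"
    "D \<in> gspan {mon k | k. set k \<subseteq> K_gens}" by (rule E_F_swap[OF i assms(2)])
  have "mon e * (gE i * gF j - scal c * (gF j * gE i) - D) \<in> uq_null m n"
    by (rule uq_null_lmult[OF D(1)])
  then have "mon (e @ [g]) * gF j - (scal c * (mon e * gF j * gE i) + mon e * D) \<in> uq_null m n"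
    by (simp add: g gen_mon[symmetric] algebra_simps scal_left)
  moreover have "mon e * gF j * gE i \<in> gspan ?B"
  proof (rule gspan_rmult[OF snoc.IH])
    fix x assume "x \<in> ?B"
    then consider e' where "x = gF j * mon e'" "set e' \<subseteq> E_gens"
      | k e' where "x = mon k * mon e'" "set k \<subseteq> K_gens" "set e' \<subseteq> E_gens" by blast
    then show "x * gE i \<in> gspan ?B"
    proof cases
      case 1
      then show ?thesis using i
        by (intro gspan.base UnI1 CollectI exI[of _ "e' @ [GE i]"]) (simp add: gen_mon mult.assoc)
    next
      case 2
      then show ?thesis using i
        by (intro gspan.base UnI2 CollectI exI[of _ k] exI[of _ "e' @ [GE i]"]) (simp add: gen_mon mult.assoc)
    qed
  qed (use snoc.prems in simp)
  moreover have "mon e * D \<in> gspan ?B"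
  proof (rule gspan_lmult[OF D(2)])
    fix x :: "'f falg" assume "x \<in> {mon k | k. set k \<subseteq> K_gens}"
    then obtain k where x: "x = mon k" and k: "set k \<subseteq> K_gens" by blast
    have "qcommute (mon e :: 'f falg) (mon k)"
      using k snoc.prems by (intro qcommute_mon_mon qcommute_K) auto
    moreover have "mon k * mon e \<in> gspan ?B"
      using k snoc.prems by (intro gspan.base UnI2 CollectI exI[of _ k] exI[of _ e]) auto
    ultimately show "mon e * x \<in> gspan ?B"
      using qcommute_gspan[of "mon e" "mon k" 1 1] by (simp add: x)
  qed
  ultimately show ?case by (rule gspan_cong[OF _ gspan.add[OF gspan.scale]])
qed

text \<open>Each new letter on the right is moved left until it reaches the end of its
  block.\<close>

lemma word_triangular:
  assumes "word_ok m n w"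
  shows "mon w \<in> gspan {mon f * mon k * mon e :: 'f::field falg | f k e.
    set f \<subseteq> F_gens \<and> set k \<subseteq> K_gens \<and> set e \<subseteq> E_gens}" (is "_ \<in> gspan ?T")
  using assms
proof (induction w rule: rev_induct)
  case Nil
  show ?case by (intro gspan.base CollectI exI[of _ "[]"]) simp
next
  case (snoc g w)
  have T: "x \<in> gspan ?T" if "x = mon f * mon k * mon e" "set f \<subseteq> F_gens" "set k \<subseteq> K_gens" "set e \<subseteq> E_gens"
    for x :: "'f falg" and f k e
    using that by (blast intro: gspan.base)
  have "mon w * gen g \<in> gspan ?T"
  proof (rule gspan_rmult[OF snoc.IH])
    show "word_ok m n w" using snoc.prems by (simp add: word_ok_def)
    fix x assume "x \<in> ?T"
    then obtain f k e where x: "x = mon f * mon k * mon e"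
      and fke: "set f \<subseteq> F_gens" "set k \<subseteq> K_gens" "set e \<subseteq> E_gens" by blast
    have "g \<in> E_gens \<union> F_gens \<union> K_gens"
      using snoc.prems gen_ok_cases by (auto simp: word_ok_def)
    then consider "g \<in> E_gens" | "g \<in> K_gens" | j where "g = GF j" "j \<in> {1..<m+n}" by blast
    then show "x * gen g \<in> gspan ?T"
    proof cases
      case 1
      then show ?thesis using fke by (intro T[of _ f k "e @ [g]"]) (auto simp: x gen_mon mult.assoc)
    next
      case 2
      then have "qcommute (mon e :: 'f falg) (gen g)"
        using fke by (intro qcommute_mon qcommute_K) auto
      moreover have "mon f * mon k * (gen g * mon e) * 1 \<in> gspan ?T"
        using 2 fke by (intro T[of _ f "k @ [g]" e]) (auto simp: gen_mon mult.assoc)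
      ultimately show ?thesis
        using qcommute_gspan[of "mon e" "gen g" "mon f * mon k" 1] by (simp add: x mult.assoc)
    next
      case 3
      have "mon f * mon k * (mon e * gF j) \<in> gspan ?T"
      proof (rule gspan_lmult[OF E_word_F[OF fke(3) 3(2)]])
        fix y :: "'f falg"
        assume "y \<in> {gF j * mon e' | e'. set e' \<subseteq> E_gens}
          \<union> {mon k * mon e' | k e'. set k \<subseteq> K_gens \<and> set e' \<subseteq> E_gens}"
        then consider e' where "y = gF j * mon e'" "set e' \<subseteq> E_gens"
          | k' e' where "y = mon k' * mon e'" "set k' \<subseteq> K_gens" "set e' \<subseteq> E_gens" by blast
        then show "mon f * mon k * y \<in> gspan ?T"
        proof cases
          case 1
          have "qcommute (mon k :: 'f falg) (gF j)"
            using fke 3 by (intro qcommute_mon qcommute_sym[OF qcommute_K]) auto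
          moreover have "mon f * (gF j * mon k) * mon e' \<in> gspan ?T"
            using 1 3 fke by (intro T[of _ "f @ [GF j]" k e']) (auto simp: gen_mon mult.assoc)
          ultimately show ?thesis
            using qcommute_gspan[of "mon k" "gF j" "mon f" "mon e'"] by (simp add: 1 mult.assoc)
        next
          case 2
          then show ?thesis using fke by (intro T[of _ f "k @ k'" e']) (auto simp: mult.assoc)
        qed
      qed
      then show ?thesis by (simp add: x 3 mult.assoc)
    qed
  qed
  then show ?case by (simp add: gen_mon)
qed

subsection \<open>The decomposition\<close>

lemma word_decomposition:
  "mon w \<in> gspan {Omega_free e * mon u * e' :: 'f::field falg | e u e'.
    e \<in> E1_set \<and> set u \<subseteq> even_gens \<and> e' \<in> E1_set}" (is "_ \<in> gspan ?V")
proof (cases "word_ok m n w")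
  case False
  then show ?thesis by (intro gspan.null uq_null_not_ok)
next
  case True
  then show ?thesis
  proof (rule gspan_trans[OF word_triangular])
    fix x :: "'f falg"
    assume "x \<in> {mon f * mon k * mon e | f k e. set f \<subseteq> F_gens \<and> set k \<subseteq> K_gens \<and> set e \<subseteq> E_gens}"
    then obtain f k e where x: "x = mon f * mon k * mon e"
      and fke: "set f \<subseteq> F_gens" "set k \<subseteq> K_gens" "set e \<subseteq> E_gens" by blast
    have k: "set k \<subseteq> even_gens" using fke(2) by (auto simp: even_gens_def)
    have "mon f * (mon k * mon e) \<in> gspan ?V"
    proof (rule gspan_rmult[OF F_word_gspan[OF fke(1)]])
      fix y :: "'f falg" assume "y \<in> {Omega_free e * mon u | u e. set u \<subseteq> even_gens \<and> e \<in> E1_set}"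
      then obtain u e1 where y: "y = Omega_free e1 * mon u" and u: "set u \<subseteq> even_gens" "e1 \<in> E1_set" by blast
      have "Omega_free e1 * mon (u @ k) * mon e \<in> gspan ?V"
      proof (rule gspan_lmult[OF E_word_gspan[OF fke(3)]])
        fix z :: "'f falg" assume "z \<in> {mon u * e | u e. set u \<subseteq> even_gens \<and> e \<in> E1_set}"
        then obtain u' e2 where z: "z = mon u' * e2" and u': "set u' \<subseteq> even_gens" "e2 \<in> E1_set" by blast
        \<comment> \<open>The three even words merge into the middle factor.\<close>
        have "Omega_free e1 * mon (u @ k @ u') * e2 \<in> gspan ?V"
          by (rule gspan.base, rule CollectI, rule exI[of _ e1], rule exI[of _ "u @ k @ u'"], rule exI[of _ e2])
            (use u u' k in simp)
        then show "Omega_free e1 * mon (u @ k) * z \<in> gspan ?V" by (simp add: z mult.assoc)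
      qed
      then show "y * (mon k * mon e) \<in> gspan ?V" by (simp add: y mult.assoc)
    qed
    then show "x \<in> gspan ?V" by (simp add: x mult.assoc)
  qed
qed

text \<open>Linear extension from words; it covers the whole type because inadmissible words are
  null.\<close>

lemma decomposition:
  "(x :: 'f::field falg) \<in> gspan {Omega_free e * mon u * e' | e u e'.
    e \<in> E1_set \<and> set u \<subseteq> even_gens \<and> e' \<in> E1_set}" (is "_ \<in> gspan ?V")
proof -
  have "(\<Sum>w\<in>A. Poly_Mapping.single w (Poly_Mapping.lookup x w)) \<in> gspan ?V" for A
  proof (induction A rule: infinite_finite_induct)
    case (insert w A)
    have eq: "Poly_Mapping.single w (Poly_Mapping.lookup x w) = scal (Poly_Mapping.lookup x w) * mon w"
      by (simp add: scal_def mon_def mult_single plus_list_def)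
    have "Poly_Mapping.single w (Poly_Mapping.lookup x w) \<in> gspan ?V"
      unfolding eq by (rule gspan.scale[OF word_decomposition])
    then show ?case unfolding sum.insert[OF insert.hyps] by (rule gspan.add[OF _ insert.IH])
  qed (auto intro: gspan.null)
  then show ?thesis by (subst falg_sum_single)
qed

section \<open>Passage to the quotient algebra\<close>

lemma E1_closed: "(E1 m n d :: 'f::field falg) \<in> carrier (free_alg m n)"
proof -
  have *: "prod_list xs \<in> carrier (free_alg m n)" if "set xs \<subseteq> carrier (free_alg m n)" for xs :: "'f falg list"
    using that by (induction xs) auto
  show ?thesis unfolding E1_def by (rule *) (auto simp: roots_iff)
qed

lemma cls_mon_even:
  assumes "set u \<subseteq> even_gens"
  shows "(mon u :: 'f::field falg) \<in> carrier (free_alg m n) \<and> cls m n (mon u) \<in> (Uq_even m n :: 'f falg set set)"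
  using assms
proof (induction u)
  case Nil
  have "cls m n (scal 1) \<in> (Uq_even m n :: 'f falg set set)"
    unfolding Uq_even_def by (intro generate_ring.incl) blast
  then show ?case by simp
next
  case (Cons g u)
  have g: "gen_ok m n g" "g \<noteq> GE m" "g \<noteq> GF m" using Cons.prems by (auto simp: even_gens_def)
  then have "cls m n (gen g) \<in> (Uq_even m n :: 'f falg set set)"
    unfolding Uq_even_def by (intro generate_ring.incl imageI) (cases g, auto)
  then show ?case using Cons g unfolding mon_Cons
    by (auto simp: cls_mult[OF mn] Uq_even_def intro: generate_ring.eng_mult)
qed

lemma zero_Uq: "\<zero>\<^bsub>Uq m n\<^esub> = cls m n 0"
  by (simp add: cls_def'[OF mn]) (simp add: Uq_def FactRing_def)

lemma Uq_span_closed: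
  assumes "S \<subseteq> carrier (Uq m n :: 'f::field falg set ring)"
  shows "Uq_span m n S \<subseteq> carrier (Uq m n)"
proof
  interpret Uq: ring "Uq m n :: 'f falg set ring" by (rule ring_Uq[OF mn])
  have scal: "cls m n (scal c) \<in> carrier (Uq m n)" for c :: "'f ratfun"
    by (simp add: carrier_Uq[OF mn])
  fix x assume "x \<in> Uq_span m n S"
  then show "x \<in> carrier (Uq m n)"
    by induction (use assms scal in auto)
qed

end

theorem theorem5p16:
  fixes m n :: nat
  assumes "m \<ge> 1" and "n \<ge> 1"
  shows "carrier (Uq m n :: 'f::field_char_0 falg set ring) =
    Uq_span m n {x \<otimes>\<^bsub>Uq m n\<^esub> u \<otimes>\<^bsub>Uq m n\<^esub> y | x u y.
      x \<in> N_minus m n \<and> u \<in> Uq_even m n \<and> y \<in> N_plus m n}"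
    (is "?U = Uq_span m n ?S")
proof -
  interpret uq_rank m n by unfold_locales (use assms in auto)
  interpret Uq: ring "Uq m n :: 'f falg set ring" by (rule ring_Uq[OF mn])
  have plus: "N_plus m n \<subseteq> ?U"
    unfolding N_plus_def by (intro Uq_span_closed) (auto simp: carrier_Uq[OF mn] E1_closed)
  then have minus: "N_minus m n \<subseteq> ?U"
    unfolding N_minus_def using Omega_closed[OF mn] by blast
  have even: "Uq_even m n \<subseteq> ?U"
    unfolding Uq_even_def by (intro Uq.generate_ring_incl) (auto simp: carrier_Uq[OF mn])
  have "Uq_span m n ?S \<subseteq> ?U"
    using plus minus even by (intro Uq_span_closed) (auto intro!: Uq.m_closed)
  \<comment> \<open>Multiplicativity of \<open>cls\<close> is available on the carrier, while
    elements of \<open>gspan\<close> range over the whole type; the projection mediates in the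
    induction.\<close>
  moreover have "cls m n (ok_part m n x) \<in> Uq_span m n ?S" for x :: "'f falg"
    using decomposition[of x]
  proof induction
    case (null x)
    then have "cls m n (ok_part m n x) = \<zero>\<^bsub>Uq m n\<^esub>"
      by (simp add: zero_Uq cls_eq_iff[OF mn] uq_null_def)
    then show ?case by (simp add: Uq_span.zero)
  next
    case (add x y)
    then show ?case by (simp add: cls_add[OF mn] Uq_span.add)
  next
    case (scale x c)
    then show ?case by (simp add: cls_mult[OF mn] Uq_span.scale)
  next
    case (base x)
    then obtain d u d' where x: "x = Omega_free (E1 m n d) * mon u * E1 m n d'"
      and d: "\<forall>p \<in> set (odd_roots m n). d p \<in> {0, 1}" "\<forall>p \<in> set (odd_roots m n). d' p \<in> {0, 1}"
      and u: "set u \<subseteq> even_gens" by auto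
    have "cls m n (ok_part m n x) = Omega m n (cls m n (E1 m n d)) \<otimes>\<^bsub>Uq m n\<^esub> cls m n (mon u)
        \<otimes>\<^bsub>Uq m n\<^esub> cls m n (E1 m n d')"
      using cls_mon_even[OF u, where 'f = 'f]
      by (simp add: x ok_part_Omega_free ok_part_id E1_closed cls_mult[OF mn] Omega_cls[OF mn])
    moreover have "cls m n (E1 m n d) \<in> N_plus m n" "cls m n (E1 m n d') \<in> N_plus m n"
      unfolding N_plus_def using d by (auto intro: Uq_span.base)
    ultimately have "cls m n (ok_part m n x) \<in> ?S"
      using cls_mon_even[OF u, where 'f = 'f] unfolding N_minus_def by blast
    then show ?case by (rule Uq_span.base)
  qed
  then have "cls m n x \<in> Uq_span m n ?S" if "x \<in> carrier (free_alg m n)" for x :: "'f falg"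
    by (subst ok_part_id[OF that, symmetric])
  then have "?U \<subseteq> Uq_span m n ?S"
    unfolding carrier_Uq[OF mn] by (rule image_subsetI)
  ultimately show ?thesis by (rule subset_antisym[rotated])
qed

end
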